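(* There exist sets $\Lambda, S \subseteq \mathbb{R}$, both discrete, nonzero complex numbers $c_\lambda$ ($\lambda\in\Lambda$) and nonzero complex numbers $d_s$ ($s \in S$) such that: (i) $\nu = \sum_{\lambda\in\Lambda} c_\lambda \delta_\lambda$ is a translation bounded measure on $\mathbb{R}$; (ii) the Fourier Transform of $\nu$ (in the sense of tempered distributions) is the measure $\widehat{\nu} = \sum_{s\in S} d_s \delta_s$, and this is also a translation bounded measure; (iii) $\Lambda$ is not contained in any finite union of arithmetic progressions, and $S$ is not contained in any finite union of arithmetic progressions. Therefore the Fourier pair $(\nu,\widehat{\nu})$ cannot be derived by finitely many applications of the Poisson Summation Formula; that is, $\nu$ is not a finite complex linear combination of measures each obtained from $\sum_{n\in\mathbb{Z}}\delta_n$ by a finite composition of translations, modulations and dilations.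
   Context: $\delta_a$ denotes the unit point mass at $a\in\mathbb{R}$. Measures are complex-valued and locally finite on $\mathbb{R}$. A subset of $\mathbb{R}$ is called discrete if it has only finitely many points in every bounded interval. A measure $\nu$ on $\mathbb{R}$ is translation bounded if its total variation on intervals of unit length is uniformly bounded: $\sup_{x\in\mathbb{R}} |\nu|([x,x+1]) < \infty$. Such a measure is a tempered distribution. The Fourier Transform of a Schwartz function $f\in\mathcal{S}(\mathbb{R})$ is $\widehat{f}(\xi)=\int_{\mathbb{R}} e^{-2\pi i \xi x} f(x)\,dx$, and for a tempered distribution $\nu$ it is defined by $\widehat{\nu}(\phi)=\nu(\widehat{\phi})$ for $\phi\in\mathcal{S}(\mathbb{R})$. An arithmetic progression is a set of the form $\{a+bn : n\in\mathbb{Z}\}$ with $a,b\in\mathbb{R}$, $b>0$. The Poisson Summation Formula is the identity $\left(\sum_{n\in\mathbb{Z}}\delta_n\right)^{\wedge}=\sum_{n\in\mathbb{Z}}\delta_n$. Translation by $r\in\mathbb{R}$ is the push-forward under $x\mapsto x+r$; modulation by $a\in\mathbb{R}$ is multiplication by the function $x\mapsto e^{2\pi i a x}$; dilation by $t\neq 0$ is the push-forward under $x\mapsto tx$. *)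

theory Defs
  imports "HOL-Analysis.Analysis"
begin

section \<open>Locally finite complex measures on the real line\<close>

text \<open>A locally finite complex measure is a countably additive complex-valued function on the
  bounded Borel sets. It is represented by a function on all sets of reals whose values off
  the bounded Borel sets are irrelevant; two such functions denote the same measure iff they
  agree on the bounded Borel sets.\<close>

definition bounded_borel :: "real set set" where
  "bounded_borel = {A \<in> sets borel. bounded A}"

definition complex_measure :: "(real set \<Rightarrow> complex) \<Rightarrow> bool" where
  "complex_measure \<nu> \<longleftrightarrow>
     (\<forall>F :: nat \<Rightarrow> real set. disjoint_family F \<longrightarrow> range F \<subseteq> bounded_borel \<longrightarrow> bounded (\<Union>i. F i) \<longrightarrow>
        (\<lambda>i. \<nu> (F i)) sums \<nu> (\<Union>i. F i))"

definition eq_measure :: "(real set \<Rightarrow> complex) \<Rightarrow> (real set \<Rightarrow> complex) \<Rightarrow> bool" where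
  "eq_measure \<mu> \<nu> \<longleftrightarrow> (\<forall>A \<in> bounded_borel. \<mu> A = \<nu> A)"

definition total_variation :: "(real set \<Rightarrow> complex) \<Rightarrow> real set \<Rightarrow> ennreal" where
  "total_variation \<nu> A =
     (SUP F \<in> {F :: nat \<Rightarrow> real set. disjoint_family F \<and> range F \<subseteq> bounded_borel \<and> (\<Union>i. F i) = A}.
        \<Sum>i. ennreal (cmod (\<nu> (F i))))"

definition translation_bounded_measure :: "(real set \<Rightarrow> complex) \<Rightarrow> bool" where
  "translation_bounded_measure \<nu> \<longleftrightarrow>
     complex_measure \<nu> \<and> (SUP x. total_variation \<nu> {x..x + 1}) < \<infinity>"

text \<open>Integration uses the Jordan decompositions of the real and imaginary parts. The positive
  part of a signed measure is its upper variation; the empty set and the truncation of negative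
  values by \<^const>\<open>ennreal\<close> make the supremum nonnegative. Passing through bounded subsets
  gives a value on unbounded Borel sets, where the signed measure itself need not be defined.\<close>

definition pos_part :: "(real set \<Rightarrow> real) \<Rightarrow> real measure" where
  "pos_part \<mu> = measure_of UNIV (sets borel) (\<lambda>A. SUP B \<in> {B \<in> bounded_borel. B \<subseteq> A}. ennreal (\<mu> B))"

definition cm_integrable :: "(real set \<Rightarrow> complex) \<Rightarrow> (real \<Rightarrow> complex) \<Rightarrow> bool" where
  "cm_integrable \<nu> f \<longleftrightarrow>
     integrable (pos_part (\<lambda>A. Re (\<nu> A))) f \<and> integrable (pos_part (\<lambda>A. - Re (\<nu> A))) f \<and>
     integrable (pos_part (\<lambda>A. Im (\<nu> A))) f \<and> integrable (pos_part (\<lambda>A. - Im (\<nu> A))) f"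

definition cm_integral :: "(real set \<Rightarrow> complex) \<Rightarrow> (real \<Rightarrow> complex) \<Rightarrow> complex" where
  "cm_integral \<nu> f =
     (integral\<^sup>L (pos_part (\<lambda>A. Re (\<nu> A))) f - integral\<^sup>L (pos_part (\<lambda>A. - Re (\<nu> A))) f) +
     \<i> * (integral\<^sup>L (pos_part (\<lambda>A. Im (\<nu> A))) f - integral\<^sup>L (pos_part (\<lambda>A. - Im (\<nu> A))) f)"

definition point_mass :: "real \<Rightarrow> real set \<Rightarrow> complex" where
  "point_mass a A = indicator A a"

text \<open>The measure \<open>\<Sum>\<^sub>l\<^sub>\<in>\<^sub>L c\<^sub>l \<delta>\<^sub>l\<close>. When \<open>L\<close> has finitely many points in each bounded interval,
  only finitely many terms are nonzero on a bounded set.\<close>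

definition point_sum :: "real set \<Rightarrow> (real \<Rightarrow> complex) \<Rightarrow> real set \<Rightarrow> complex" where
  "point_sum L c A = (\<Sum>\<^sub>\<infinity>l\<in>L. c l * point_mass l A)"


section \<open>Schwartz functions, tempered distributions and the Fourier transform\<close>

definition nderiv :: "nat \<Rightarrow> (real \<Rightarrow> complex) \<Rightarrow> real \<Rightarrow> complex" where
  "nderiv k = (\<lambda>f x. vector_derivative f (at x)) ^^ k"

definition schwartz :: "(real \<Rightarrow> complex) \<Rightarrow> bool" where
  "schwartz f \<longleftrightarrow>
     (\<forall>k x. nderiv k f differentiable (at x)) \<and>
     (\<forall>j k. bounded (range (\<lambda>x. x ^ j *\<^sub>R nderiv k f x)))"

definition schwartz_seminorm :: "nat \<Rightarrow> nat \<Rightarrow> (real \<Rightarrow> complex) \<Rightarrow> real" where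
  "schwartz_seminorm j k f = (SUP x. cmod (x ^ j *\<^sub>R nderiv k f x))"

text \<open>A tempered distribution is represented by a functional on all functions, of which only the
  restriction to Schwartz functions matters. For a linear functional, continuity in the Schwartz
  topology is domination by finitely many seminorms.\<close>

definition tempered_distribution :: "((real \<Rightarrow> complex) \<Rightarrow> complex) \<Rightarrow> bool" where
  "tempered_distribution T \<longleftrightarrow>
     (\<forall>f g a b. schwartz f \<longrightarrow> schwartz g \<longrightarrow> T (\<lambda>x. a * f x + b * g x) = a * T f + b * T g) \<and>
     (\<exists>C N. \<forall>f. schwartz f \<longrightarrow> cmod (T f) \<le> C * (\<Sum>j\<le>N. \<Sum>k\<le>N. schwartz_seminorm j k f))"

definition tempered_measure :: "(real set \<Rightarrow> complex) \<Rightarrow> bool" where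
  "tempered_measure \<nu> \<longleftrightarrow>
     complex_measure \<nu> \<and> (\<forall>f. schwartz f \<longrightarrow> cm_integrable \<nu> f) \<and>
     tempered_distribution (cm_integral \<nu>)"

definition fourier :: "(real \<Rightarrow> complex) \<Rightarrow> real \<Rightarrow> complex" where
  "fourier f \<xi> = (LINT x|lborel. exp (- 2 * complex_of_real pi * \<i> * complex_of_real \<xi> * complex_of_real x) * f x)"

definition fourier_distribution ::
    "((real \<Rightarrow> complex) \<Rightarrow> complex) \<Rightarrow> (real \<Rightarrow> complex) \<Rightarrow> complex" where
  "fourier_distribution T \<phi> = T (fourier \<phi>)"

text \<open>The Fourier transform of \<open>\<nu>\<close>, as a tempered distribution, is the measure \<open>\<mu>\<close>.\<close>

definition has_fourier_transform :: "(real set \<Rightarrow> complex) \<Rightarrow> (real set \<Rightarrow> complex) \<Rightarrow> bool" where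
  "has_fourier_transform \<nu> \<mu> \<longleftrightarrow>
     tempered_measure \<nu> \<and> tempered_measure \<mu> \<and>
     (\<forall>\<phi>. schwartz \<phi> \<longrightarrow> fourier_distribution (cm_integral \<nu>) \<phi> = cm_integral \<mu> \<phi>)"


section \<open>Discrete sets and arithmetic progressions\<close>

definition discrete_subset :: "real set \<Rightarrow> bool" where
  "discrete_subset L \<longleftrightarrow> (\<forall>a b. finite (L \<inter> {a..b}))"

definition arithmetic_progression :: "real set \<Rightarrow> bool" where
  "arithmetic_progression P \<longleftrightarrow> (\<exists>a b. b > 0 \<and> P = {a + b * of_int n | n :: int. True})"

definition in_finite_union_of_APs :: "real set \<Rightarrow> bool" where
  "in_finite_union_of_APs L \<longleftrightarrow>
     (\<exists>\<P>. finite \<P> \<and> (\<forall>P \<in> \<P>. arithmetic_progression P) \<and> L \<subseteq> \<Union>\<P>)"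


section \<open>Measures derived from the Poisson summation formula\<close>

definition push_forward :: "(real \<Rightarrow> real) \<Rightarrow> (real set \<Rightarrow> complex) \<Rightarrow> real set \<Rightarrow> complex" where
  "push_forward h \<nu> A = \<nu> (h -` A)"

definition mult_measure :: "(real \<Rightarrow> complex) \<Rightarrow> (real set \<Rightarrow> complex) \<Rightarrow> real set \<Rightarrow> complex" where
  "mult_measure g \<nu> A = cm_integral \<nu> (\<lambda>x. indicator A x * g x)"

definition translation :: "real \<Rightarrow> (real set \<Rightarrow> complex) \<Rightarrow> real set \<Rightarrow> complex" where
  "translation r = push_forward (\<lambda>x. x + r)"

definition modulation :: "real \<Rightarrow> (real set \<Rightarrow> complex) \<Rightarrow> real set \<Rightarrow> complex" where
  "modulation a = mult_measure (\<lambda>x. exp (2 * complex_of_real pi * \<i> * complex_of_real a * complex_of_real x))"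

definition dilation :: "real \<Rightarrow> (real set \<Rightarrow> complex) \<Rightarrow> real set \<Rightarrow> complex" where
  "dilation t = push_forward (\<lambda>x. t * x)"

definition dirac_comb :: "real set \<Rightarrow> complex" where
  "dirac_comb = point_sum \<int> (\<lambda>_. 1)"

inductive comb_orbit :: "(real set \<Rightarrow> complex) \<Rightarrow> bool" where
  comb: "comb_orbit dirac_comb"
| translate: "comb_orbit \<mu> \<Longrightarrow> comb_orbit (translation r \<mu>)"
| modulate: "comb_orbit \<mu> \<Longrightarrow> comb_orbit (modulation a \<mu>)"
| dilate: "comb_orbit \<mu> \<Longrightarrow> t \<noteq> 0 \<Longrightarrow> comb_orbit (dilation t \<mu>)"

definition finitely_poisson_derived :: "(real set \<Rightarrow> complex) \<Rightarrow> bool" where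
  "finitely_poisson_derived \<nu> \<longleftrightarrow>
     (\<exists>(n :: nat) (a :: nat \<Rightarrow> complex) \<mu>.
        (\<forall>i<n. comb_orbit (\<mu> i)) \<and> eq_measure \<nu> (\<lambda>A. \<Sum>i<n. a i * \<mu> i A))"

end

theory Submission
  imports Defs "HOL-Probability.Sinc_Integral"
begin

text \<open>The measure is a sum \<open>\<nu> = \<Sum>\<^sub>n \<epsilon>\<^sub>n \<nu>\<^sub>n\<close>, following Kolountzakis. Each \<open>\<nu>\<^sub>n\<close> is a periodic weight
  on a lattice \<open>h\<^sub>n\<int>\<close>, so by Poisson summation its Fourier transform is a periodic weight on a dual
  lattice, given by the discrete Fourier transform. The weights are the coefficients of a polynomial
  with prescribed roots of unity, chosen so that both \<open>\<nu>\<^sub>n\<close> and its transform vanish on an interval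
  around \<open>0\<close> whose length grows with \<open>n\<close>; this makes both total supports discrete. Taking
  \<open>h\<^sub>n = 1 / (n + sqrt 2)\<close> makes the lattices, and the dual lattices, pairwise incommensurable. Hence
  there is no cancellation, and an arithmetic progression meets at most one of the lattices in more
  than one point, so finitely many progressions cannot cover the support. A finite combination of
  images of the Dirac comb, on the other hand, lives on finitely many progressions.\<close>

section \<open>Decay estimates\<close>

text \<open>The two gaps compete. A weight of period N on the lattice of spacing h has its transform
  on the lattice of spacing 1 / (N h); if both vanish at indices below M in absolute value, the gaps
  reach M h in space and M / (N h) in frequency. Prescribing the 2M - 1 zeros in frequency as roots
  of a polynomial yields 2M coefficients, which fit into the half of a period of length N = 4M away
  from 0. The product of the two gaps is then M / 4, and with 1 / h about n the gap M h grows only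
  if M is superlinear in n; a square does it. The factors \<open>\<epsilon> n\<close> are chosen
  after the weights and for both sides at once, so crude bounds on the polynomial coefficients
  suffice. All sums converge absolutely against 1 / (1 + x^2). The transform of a Schwartz test
  function enters only through measurability and this decay, and integrals defined by Jordan parts
  are first turned into plain sums over atoms for all functions of this kind.\<close>

lemma schwartz_measurable:
  assumes "schwartz f"
  shows "f \<in> borel_measurable borel"
proof -
  have "f differentiable (at x)" for x
    using assms unfolding schwartz_def nderiv_def by (metis funpow_0)
  then have "continuous_on UNIV f"
    by (simp add: continuous_at_imp_continuous_on differentiable_imp_continuous_within)
  then show ?thesis by (rule borel_measurable_continuous_onI)
qed

lemma schwartz_seminorm_upper:
  assumes "schwartz f"
  shows "cmod (x ^ j *\<^sub>R nderiv k f x) \<le> schwartz_seminorm j k f"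
  unfolding schwartz_seminorm_def
proof (rule cSUP_upper)
  show "bdd_above (range (\<lambda>x. cmod (x ^ j *\<^sub>R nderiv k f x)))"
    using assms unfolding schwartz_def
    by (metis (no_types, lifting) bdd_aboveI2 bounded_iff rangeI)
qed simp

text \<open>Adding the seminorm bounds for the powers 0 and 2 gives the form of decay used from here
  on: the weight \<open>1 / (1 + x^2)\<close> is integrable and summable over the integers.\<close>

lemma schwartz_nderiv_decay:
  assumes "schwartz f"
  shows "cmod (nderiv k f x) \<le> (schwartz_seminorm 0 k f + schwartz_seminorm 2 k f) / (1 + x\<^sup>2)"
  using schwartz_seminorm_upper[OF assms, of x 0 k] schwartz_seminorm_upper[OF assms, of x 2 k]
  by (simp add: field_simps add_pos_nonneg)

lemma schwartz_seminorm_nonneg: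
  assumes "schwartz f"
  shows "0 \<le> schwartz_seminorm j k f"
  using schwartz_seminorm_upper[OF assms, of 0 j k] norm_ge_zero order_trans by blast

lemma schwartz_decay:
  assumes "schwartz f"
  shows "cmod (f x) \<le> (schwartz_seminorm 0 0 f + schwartz_seminorm 2 0 f) / (1 + x\<^sup>2)"
  using schwartz_nderiv_decay[OF assms, of 0 x] by (simp add: nderiv_def)

text \<open>Lets the decay weight move by a distance of at most 1 at the cost of a factor 3; used to
  compare a point with a nearby integer or with a small translate.\<close>

lemma one_plus_square_le:
  fixes x y :: real
  assumes "\<bar>x - y\<bar> \<le> 1"
  shows "1 + x\<^sup>2 \<le> 3 * (1 + y\<^sup>2)"
proof -
  have "(x - y)\<^sup>2 \<le> 1" using assms by (simp add: abs_square_le_1)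
  \<comment> \<open>Parallelogram law for \<open>x - y\<close> and \<open>y\<close>.\<close>
  moreover have "x\<^sup>2 + (x - 2 * y)\<^sup>2 = 2 * (x - y)\<^sup>2 + 2 * y\<^sup>2"
    by (simp add: power2_eq_square algebra_simps)
  ultimately have "x\<^sup>2 \<le> 2 + 2 * y\<^sup>2" by (smt (verit) zero_le_power2)
  then show ?thesis by (smt (verit) zero_le_power2)
qed

lemma summable_on_inverse_square_int:
  "(\<lambda>k::int. 1 / (1 + (real_of_int k)\<^sup>2)) summable_on UNIV"
proof -
  have nat: "(\<lambda>n::nat. 1 / (1 + (real n)\<^sup>2)) summable_on UNIV"
  proof -
    have "summable (\<lambda>n::nat. 1 / (1 + (real n)\<^sup>2))"
    proof (rule summable_comparison_test)
      show "summable (\<lambda>n. inverse (real n ^ 2))" by (rule inverse_power_summable) simp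
      show "\<exists>N. \<forall>n\<ge>N. norm (1 / (1 + (real n)\<^sup>2)) \<le> inverse (real n ^ 2)"
        by (intro exI[of _ 1]) (auto simp: field_simps add_pos_nonneg)
    qed
    then show ?thesis by (simp add: summable_on_UNIV_nonneg_real_iff)
  qed
  have "(\<lambda>k::int. 1 / (1 + (real_of_int k)\<^sup>2)) summable_on (range int \<union> range (\<lambda>n. - int n))"
    using nat by (intro summable_on_union) (auto simp: summable_on_reindex inj_def comp_def)
  moreover have "range int \<union> range (\<lambda>n. - int n) = UNIV"
    by (auto simp: image_iff) (metis int_cases2)
  ultimately show ?thesis by simp
qed

section \<open>Purely atomic measures\<close>

lemma finite_discrete_Int_bounded:
  assumes "discrete_subset L" "bounded A"
  shows "finite (L \<inter> A)"
proof -
  obtain a where "\<forall>x\<in>A. \<bar>x\<bar> \<le> a"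
    using assms(2) unfolding bounded_iff by auto
  then have "L \<inter> A \<subseteq> L \<inter> {-a..a}"
    by (auto simp: abs_le_iff)
  then show ?thesis
    using assms(1) finite_subset unfolding discrete_subset_def by blast
qed

lemma point_sum_bounded:
  assumes "discrete_subset L" "bounded A"
  shows "point_sum L c A = sum c (L \<inter> A)"
proof -
  have "point_sum L c A = (\<Sum>\<^sub>\<infinity>l\<in>L \<inter> A. c l)"
    unfolding point_sum_def point_mass_def by (intro infsum_cong_neutral) auto
  then show ?thesis
    using finite_discrete_Int_bounded[OF assms] by simp
qed

lemma point_sum_singleton:
  "point_sum L c {x} = (if x \<in> L then c x else 0)"
proof -
  have "point_sum L c {x} = (\<Sum>\<^sub>\<infinity>l\<in>L \<inter> {x}. c l)"
    unfolding point_sum_def point_mass_def by (intro infsum_cong_neutral) auto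
  then show ?thesis by auto
qed

lemma singleton_bounded_borel: "{x} \<in> bounded_borel"
  by (simp add: bounded_borel_def)

lemma finite_bounded_borel: "finite B \<Longrightarrow> B \<in> bounded_borel"
  by (simp add: bounded_borel_def finite_imp_bounded borel_closed finite_imp_closed)

text \<open>The union is bounded, so only finitely many atoms \<open>X\<close> matter; countable
  additivity is a finite sum of the additivity of indicators at single atoms.\<close>

lemma complex_measure_point_sum:
  assumes "discrete_subset L"
  shows "complex_measure (point_sum L c)"
  unfolding complex_measure_def
proof (intro allI impI)
  fix F :: "nat \<Rightarrow> real set"
  assume F: "disjoint_family F" "range F \<subseteq> bounded_borel" "bounded (\<Union>i. F i)"
  define X where "X = L \<inter> (\<Union>i. F i)"
  have X: "finite X" unfolding X_def by (rule finite_discrete_Int_bounded[OF assms F(3)])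
  have b: "bounded (F i)" for i using F(2) by (auto simp: bounded_borel_def)
  have eq: "point_sum L c A = (\<Sum>l\<in>X. c l * indicator A l)" if "bounded A" "A \<subseteq> (\<Union>i. F i)" for A
  proof -
    have "(\<Sum>l\<in>X. c l * indicator A l) = sum c (X \<inter> A)"
      using X by (simp add: indicator_def if_distrib sum.If_cases cong: if_cong)
    moreover have "X \<inter> A = L \<inter> A" using that by (auto simp: X_def)
    ultimately show ?thesis using point_sum_bounded[OF assms that(1)] by simp
  qed
  have "(\<lambda>i. c l * indicator (F i) l) sums (c l * indicator (\<Union>i. F i) l)" for l
  proof -
    have "(\<lambda>i. indicator (F i) l :: real) sums indicator (\<Union>i. F i) l"
      using F(1) by (intro indicator_sums) (auto simp: disjoint_family_on_def)
    then have "(\<lambda>i. complex_of_real (indicator (F i) l)) sums complex_of_real (indicator (\<Union>i. F i) l)"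
      by (simp add: sums_of_real_iff)
    then have "(\<lambda>i. indicator (F i) l :: complex) sums indicator (\<Union>i. F i) l"
      by (simp add: of_real_indicator)
    then show ?thesis by (rule sums_mult)
  qed
  then have "(\<lambda>i. \<Sum>l\<in>X. c l * indicator (F i) l) sums (\<Sum>l\<in>X. c l * indicator (\<Union>i. F i) l)"
    by (intro sums_sum) 
  moreover have "point_sum L c (F i) = (\<Sum>l\<in>X. c l * indicator (F i) l)" for i
    by (intro eq b) auto
  ultimately show "(\<lambda>i. point_sum L c (F i)) sums point_sum L c (\<Union>i. F i)"
    using eq[OF F(3)] by simp
qed

text \<open>Triangle inequality on each piece; the pieces are disjoint, so every atom of
  \<open>A\<close> is counted at most once.\<close>

lemma total_variation_point_sum_le:
  assumes "discrete_subset L" "bounded A"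
  shows "total_variation (point_sum L c) A \<le> ennreal (\<Sum>l\<in>L \<inter> A. cmod (c l))"
  unfolding total_variation_def
proof (intro SUP_least)
  fix F :: "nat \<Rightarrow> real set"
  assume "F \<in> {F. disjoint_family F \<and> range F \<subseteq> bounded_borel \<and> (\<Union>i. F i) = A}"
  then have F: "disjoint_family F" "range F \<subseteq> bounded_borel" "(\<Union>i. F i) = A" by auto
  have b: "bounded (F i)" for i using F(2) by (auto simp: bounded_borel_def)
  have X: "finite (L \<inter> B)" if "bounded B" for B using finite_discrete_Int_bounded[OF assms(1) that] .
  have "(\<Sum>i<n. ennreal (cmod (point_sum L c (F i)))) \<le> ennreal (\<Sum>l\<in>L \<inter> A. cmod (c l))" for n
  proof -
    have "(\<Sum>i<n. cmod (point_sum L c (F i))) \<le> (\<Sum>i<n. \<Sum>l\<in>L \<inter> F i. cmod (c l))"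
      by (intro sum_mono) (simp add: point_sum_bounded[OF assms(1) b] norm_sum)
    also have "\<dots> = (\<Sum>l\<in>(\<Union>i<n. L \<inter> F i). cmod (c l))"
      using F(1) X[OF b] by (subst sum.UNION_disjoint) (auto simp: disjoint_family_on_def)
    also have "\<dots> \<le> (\<Sum>l\<in>L \<inter> A. cmod (c l))"
      using X[OF assms(2)] F(3) by (intro sum_mono2) auto
    finally show ?thesis by (simp add: sum_ennreal ennreal_leI)
  qed
  then show "(\<Sum>i. ennreal (cmod (point_sum L c (F i)))) \<le> ennreal (\<Sum>l\<in>L \<inter> A. cmod (c l))"
    by (intro suminf_le_const summableI) auto
qed

lemma translation_bounded_point_sum:
  assumes "discrete_subset L" "\<And>x. (\<Sum>l\<in>L \<inter> {x..x + 1}. cmod (c l)) \<le> B"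
  shows "translation_bounded_measure (point_sum L c)"
proof -
  have "(SUP x. total_variation (point_sum L c) {x..x + 1}) \<le> ennreal B"
    using total_variation_point_sum_le[OF assms(1)] assms(2)
    by (intro SUP_least) (meson bounded_closed_interval ennreal_leI order_trans)
  then show ?thesis
    using complex_measure_point_sum[OF assms(1)]
    by (auto simp: translation_bounded_measure_def intro: le_less_trans)
qed

section \<open>Integration against purely atomic measures\<close>

lemma has_sum_diff:
  fixes a b :: complex
  assumes "(f has_sum a) A" "(g has_sum b) A"
  shows "((\<lambda>x. f x - g x) has_sum (a - b)) A"
  using has_sum_add[OF assms(1) has_sum_uminusI[OF assms(2)]] by simp

text \<open>\<open>ennreal\<close> sends negative weights to 0, so the density
  \<open>ennreal (r l)\<close> already is the positive part. Dropping negative weights bounds each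
  \<open>\<mu> B\<close> from above; exhausting \<open>A\<close> by bounded windows and keeping the
  atoms of positive weight attains the supremum.\<close>

lemma pos_part_point_sum:
  fixes r :: "real \<Rightarrow> real"
  assumes L: "discrete_subset L" and \<mu>: "\<And>B. B \<in> bounded_borel \<Longrightarrow> \<mu> B = sum r (L \<inter> B)"
  shows "pos_part \<mu> = distr (density (count_space L) (\<lambda>l. ennreal (r l))) borel (\<lambda>x. x)"
proof -
  let ?M = "distr (density (count_space L) (\<lambda>l. ennreal (r l))) borel (\<lambda>x. x)"
  have em: "emeasure ?M A = (\<integral>\<^sup>+l. ennreal (r l) * indicator A l \<partial>count_space L)" if "A \<in> sets borel" for A
    using that by (subst emeasure_distr) (auto simp: emeasure_density indicator_def intro!: nn_integral_cong)
  have "(SUP B \<in> {B \<in> bounded_borel. B \<subseteq> A}. ennreal (\<mu> B)) = emeasure ?M A" (is "?S = _")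
    if A: "A \<in> sets borel" for A
  proof (rule antisym)
    show "?S \<le> emeasure ?M A"
    proof (rule SUP_least)
      fix B assume "B \<in> {B \<in> bounded_borel. B \<subseteq> A}"
      then have B: "B \<in> bounded_borel" "B \<subseteq> A" "bounded B" by (auto simp: bounded_borel_def)
      have fin: "finite (L \<inter> B)" using finite_discrete_Int_bounded[OF L B(3)] .
      have "ennreal (\<mu> B) \<le> ennreal (\<Sum>l\<in>L \<inter> B. max 0 (r l))"
        unfolding \<mu>[OF B(1)] by (intro ennreal_leI sum_mono) auto
      also have "\<dots> = (\<Sum>l\<in>L \<inter> B. ennreal (max 0 (r l)))"
        by (subst sum_ennreal) auto
      also have "\<dots> = (\<Sum>l\<in>L \<inter> B. ennreal (r l))"
        by (intro sum.cong) (auto simp: max_def ennreal_neg)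
      also have "\<dots> = (\<Sum>l\<in>L \<inter> B. ennreal (r l) * indicator A l)"
        using B by (intro sum.cong) (auto simp: indicator_def)
      also have "\<dots> = (\<integral>\<^sup>+l. ennreal (r l) * indicator A l \<partial>count_space (L \<inter> B))"
        using fin by (simp add: nn_integral_count_space_finite)
      also have "\<dots> \<le> (\<integral>\<^sup>+l. ennreal (r l) * indicator A l \<partial>count_space L)"
        by (subst (1 2) nn_integral_count_space_indicator) (auto simp: indicator_def intro!: nn_integral_mono)
      finally show "ennreal (\<mu> B) \<le> emeasure ?M A" using em[OF A] by simp
    qed
    show "emeasure ?M A \<le> ?S"
    proof -
      define H where "H k l = ennreal (r l) * indicator A l * indicator {-real k..real k} l" for k :: nat and l
      have "emeasure ?M A = (\<integral>\<^sup>+l. (SUP k. H k l) \<partial>count_space L)"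
        unfolding em[OF A]
      proof (intro nn_integral_cong antisym)
        fix l
        obtain k :: nat where "\<bar>l\<bar> \<le> real k" using real_arch_simple by blast
        then have "ennreal (r l) * indicator A l \<le> H k l"
          by (auto simp: H_def indicator_def)
        then show "ennreal (r l) * indicator A l \<le> (SUP k. H k l)" by (rule SUP_upper2[OF UNIV_I])
        show "(SUP k. H k l) \<le> ennreal (r l) * indicator A l"
          by (intro SUP_least) (auto simp: H_def indicator_def)
      qed
      also have "\<dots> = (SUP k. \<integral>\<^sup>+l. H k l \<partial>count_space L)"
        by (intro nn_integral_monotone_convergence_SUP)
          (auto simp: incseq_def le_fun_def H_def indicator_def)
      also have "\<dots> \<le> ?S"
      proof (rule SUP_least)
        fix k :: nat
        \<comment> \<open>A finite, hence admissible, test set that carries the whole positive mass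
          in the window.\<close>
        let ?B = "{l \<in> L \<inter> (A \<inter> {-real k..real k}). 0 < r l}"
        have fin: "finite (L \<inter> (A \<inter> {-real k..real k}))"
          by (rule finite_discrete_Int_bounded[OF L]) (meson bounded_Int bounded_closed_interval)
        have B: "finite ?B" by (rule finite_subset[OF _ fin]) auto
        have "(\<integral>\<^sup>+l. H k l \<partial>count_space L) = (\<integral>\<^sup>+l. H k l \<partial>count_space ?B)"
          by (intro nn_integral_count_space_eq)
            (auto simp: H_def indicator_def ennreal_neg not_less split: if_splits)
        also have "\<dots> = (\<integral>\<^sup>+l. ennreal (r l) \<partial>count_space ?B)"
          by (intro nn_integral_cong) (auto simp: H_def indicator_def)
        also have "\<dots> = (\<Sum>l\<in>?B. ennreal (r l))"
          using B by (rule nn_integral_count_space_finite)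
        also have "\<dots> = ennreal (\<mu> ?B)"
          using B by (subst \<mu>) (auto intro!: finite_bounded_borel sum_ennreal sum.cong simp: sum_ennreal Int_absorb1)
        also have "\<dots> \<le> ?S"
          using B by (intro SUP_upper) (auto intro: finite_bounded_borel)
        finally show "(\<integral>\<^sup>+l. H k l \<partial>count_space L) \<le> ?S" .
      qed
      finally show ?thesis .
    qed
  qed
  then have "pos_part \<mu> = measure_of UNIV (sets borel) (emeasure ?M)"
    unfolding pos_part_def by (intro measure_of_eq) (auto simp: sigma_algebra.sigma_sets_eq[OF sets.sigma_algebra_axioms[of borel, simplified]])
  also have "\<dots> = ?M"
    using measure_of_of_measure[of ?M] by simp
  finally show ?thesis .
qed

text \<open>Summability over a set is absolute for complex families, so \<open>sm\<close> dominates
  the truncated family, and absolute summability on \<open>L\<close> is integrability for the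
  counting measure on \<open>L\<close>.\<close>

lemma integral_pos_part_point_sum:
  fixes r :: "real \<Rightarrow> real" and g :: "real \<Rightarrow> complex"
  assumes L: "discrete_subset L" and \<mu>: "\<And>B. B \<in> bounded_borel \<Longrightarrow> \<mu> B = sum r (L \<inter> B)"
    and g: "g \<in> borel_measurable borel" and sm: "(\<lambda>l. of_real (r l) * g l) summable_on L"
  shows "integrable (pos_part \<mu>) g"
    and "integral\<^sup>L (pos_part \<mu>) g = (\<Sum>\<^sub>\<infinity>l\<in>L. of_real (max 0 (r l)) * g l)"
    and "(\<lambda>l. of_real (max 0 (r l)) * g l) summable_on L"
proof -
  have eq: "pos_part \<mu> = distr (density (count_space L) (\<lambda>l. ennreal (max 0 (r l)))) borel (\<lambda>x. x)"
    using pos_part_point_sum[OF L \<mu>]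
    by (simp, intro arg_cong[where f="\<lambda>M. distr M borel (\<lambda>x. x)"] density_cong) (auto simp: max_def ennreal_neg)
  have abs: "Infinite_Set_Sum.abs_summable_on (\<lambda>l. of_real (max 0 (r l)) * g l) L"
    unfolding abs_summable_equivalent[symmetric]
    by (rule summable_on_comparison_test[OF sm[unfolded summable_on_iff_abs_summable_on_complex]])
      (auto simp: norm_mult intro!: mult_right_mono)
  then show sm': "(\<lambda>l. of_real (max 0 (r l)) * g l) summable_on L"
    by (simp add: summable_on_iff_abs_summable_on_complex abs_summable_equivalent)
  show "integrable (pos_part \<mu>) g"
    unfolding eq using g abs
    by (simp add: integrable_distr_eq integrable_density abs_summable_on_def scaleR_conv_of_real)
  show "integral\<^sup>L (pos_part \<mu>) g = (\<Sum>\<^sub>\<infinity>l\<in>L. of_real (max 0 (r l)) * g l)"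
    unfolding eq using g infsetsum_infsum[OF abs]
    by (simp add: integral_distr integral_density infsetsum_def scaleR_conv_of_real)
qed

text \<open>Each of the four Jordan parts has weights dominated by \<open>cmod (c l)\<close>, and
  \<open>max 0 x - max 0 (- x) = x\<close> reassembles them. Stating it for \<open>\<nu>\<close> up
  to \<open>eq_measure\<close> is what the modulation case of \<open>comb_orbit_point_sum\<close>
  requires.\<close>

lemma cm_integral_point_sum:
  assumes L: "discrete_subset L" and \<nu>: "eq_measure \<nu> (point_sum L c)"
    and g: "g \<in> borel_measurable borel" and sm: "(\<lambda>l. c l * g l) summable_on L"
  shows "cm_integrable \<nu> g" and "cm_integral \<nu> g = (\<Sum>\<^sub>\<infinity>l\<in>L. c l * g l)"
proof -
  have \<nu>': "\<nu> B = sum c (L \<inter> B)" if "B \<in> bounded_borel" for B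
    using \<nu> that point_sum_bounded[OF L] by (auto simp: eq_measure_def bounded_borel_def)
  have abs: "(\<lambda>l. norm (c l * g l)) summable_on L"
    using sm by (simp add: summable_on_iff_abs_summable_on_complex)
  have dom: "(\<lambda>l. of_real (r l) * g l) summable_on L" if "\<And>l. \<bar>r l\<bar> \<le> norm (c l)" for r
    unfolding summable_on_iff_abs_summable_on_complex
    by (rule summable_on_comparison_test[OF abs]) (use that in \<open>auto simp: norm_mult intro!: mult_right_mono\<close>)
  note 1 = integral_pos_part_point_sum[OF L _ g dom, of "\<lambda>A. Re (\<nu> A)" "\<lambda>l. Re (c l)"]
  note 2 = integral_pos_part_point_sum[OF L _ g dom, of "\<lambda>A. - Re (\<nu> A)" "\<lambda>l. - Re (c l)"]
  note 3 = integral_pos_part_point_sum[OF L _ g dom, of "\<lambda>A. Im (\<nu> A)" "\<lambda>l. Im (c l)"]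
  note 4 = integral_pos_part_point_sum[OF L _ g dom, of "\<lambda>A. - Im (\<nu> A)" "\<lambda>l. - Im (c l)"]
  note simps = \<nu>' sum_negf abs_Re_le_cmod abs_Im_le_cmod
  show "cm_integrable \<nu> g"
    unfolding cm_integrable_def using 1(1) 2(1) 3(1) 4(1) by (simp add: simps)
  let ?p = "\<lambda>r l. complex_of_real (max 0 (r l)) * g l"
  have "cm_integral \<nu> g = (infsum (?p (\<lambda>l. Re (c l))) L - infsum (?p (\<lambda>l. - Re (c l))) L) +
      \<i> * (infsum (?p (\<lambda>l. Im (c l))) L - infsum (?p (\<lambda>l. - Im (c l))) L)"
    unfolding cm_integral_def using 1(2) 2(2) 3(2) 4(2) by (simp add: simps)
  moreover have "((\<lambda>l. (?p (\<lambda>l. Re (c l)) l - ?p (\<lambda>l. - Re (c l)) l) +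
      \<i> * (?p (\<lambda>l. Im (c l)) l - ?p (\<lambda>l. - Im (c l)) l)) has_sum 
      (infsum (?p (\<lambda>l. Re (c l))) L - infsum (?p (\<lambda>l. - Re (c l))) L) +
      \<i> * (infsum (?p (\<lambda>l. Im (c l))) L - infsum (?p (\<lambda>l. - Im (c l))) L)) L"
    using 1(3) 2(3) 3(3) 4(3)
    by (intro has_sum_add has_sum_diff has_sum_cmult_right has_sum_infsum) (simp_all add: simps)
  moreover have "(?p (\<lambda>l. Re (c l)) l - ?p (\<lambda>l. - Re (c l)) l) +
      \<i> * (?p (\<lambda>l. Im (c l)) l - ?p (\<lambda>l. - Im (c l)) l) = c l * g l" for l
  proof -
    have m: "max 0 x - max 0 (-x) = x" for x :: real by auto
    have "(?p (\<lambda>l. Re (c l)) l - ?p (\<lambda>l. - Re (c l)) l) +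
        \<i> * (?p (\<lambda>l. Im (c l)) l - ?p (\<lambda>l. - Im (c l)) l) =
      (of_real (max 0 (Re (c l)) - max 0 (- Re (c l))) + \<i> * of_real (max 0 (Im (c l)) - max 0 (- Im (c l)))) * g l"
      by (simp add: algebra_simps)
    then show ?thesis unfolding m using complex_eq by metis
  qed
  ultimately show "cm_integral \<nu> g = (\<Sum>\<^sub>\<infinity>l\<in>L. c l * g l)"
    by (simp add: infsumI)
qed

lemma summable_on_mult_decay:
  fixes f c :: "real \<Rightarrow> complex"
  assumes c: "(\<lambda>l. cmod (c l) / (1 + l\<^sup>2)) summable_on L" and f: "\<And>l. cmod (f l) \<le> C / (1 + l\<^sup>2)"
  shows "(\<lambda>l. c l * f l) summable_on L"
    and "cmod (\<Sum>\<^sub>\<infinity>l\<in>L. c l * f l) \<le> C * (\<Sum>\<^sub>\<infinity>l\<in>L. cmod (c l) / (1 + l\<^sup>2))"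
proof -
  have s: "(\<lambda>l. C * (cmod (c l) / (1 + l\<^sup>2))) summable_on L"
    using c by (rule summable_on_cmult_right)
  have le: "cmod (c l * f l) \<le> C * (cmod (c l) / (1 + l\<^sup>2))" for l
    using mult_left_mono[OF f[of l], of "cmod (c l)"] by (simp add: norm_mult mult.commute)
  have abs: "(\<lambda>l. cmod (c l * f l)) summable_on L"
    by (rule summable_on_comparison_test[OF s]) (use le in auto)
  then show "(\<lambda>l. c l * f l) summable_on L" by (rule abs_summable_summable)
  have "cmod (\<Sum>\<^sub>\<infinity>l\<in>L. c l * f l) \<le> (\<Sum>\<^sub>\<infinity>l\<in>L. cmod (c l * f l))"
    by (rule norm_infsum_bound[OF abs])
  also have "\<dots> \<le> (\<Sum>\<^sub>\<infinity>l\<in>L. C * (cmod (c l) / (1 + l\<^sup>2)))"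
    by (rule infsum_mono[OF abs s le])
  finally show "cmod (\<Sum>\<^sub>\<infinity>l\<in>L. c l * f l) \<le> C * (\<Sum>\<^sub>\<infinity>l\<in>L. cmod (c l) / (1 + l\<^sup>2))"
    by (simp only: infsum_cmult_right')
qed

lemma eq_measure_refl: "eq_measure \<mu> \<mu>"
  by (simp add: eq_measure_def)

lemma cm_integral_point_sum_decay:
  assumes "discrete_subset L" "(\<lambda>l. cmod (c l) / (1 + l\<^sup>2)) summable_on L"
    and "f \<in> borel_measurable borel" "\<And>x. cmod (f x) \<le> C / (1 + x\<^sup>2)"
  shows "cm_integral (point_sum L c) f = (\<Sum>\<^sub>\<infinity>l\<in>L. c l * f l)"
  by (intro cm_integral_point_sum[OF assms(1) eq_measure_refl assms(3)] summable_on_mult_decay[OF assms(2,4)])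

text \<open>Continuity comes from the two seminorms with \<open>k = 0\<close> and
  \<open>j = 0, 2\<close>; the order 2 in the double sum is chosen to include both.\<close>

lemma tempered_measure_point_sum:
  assumes L: "discrete_subset L" and c: "(\<lambda>l. cmod (c l) / (1 + l\<^sup>2)) summable_on L"
  shows "tempered_measure (point_sum L c)"
proof -
  note sw = summable_on_mult_decay[OF c schwartz_decay]
  have eq: "cm_integral (point_sum L c) f = (\<Sum>\<^sub>\<infinity>l\<in>L. c l * f l)" if "schwartz f" for f
    using cm_integral_point_sum_decay[OF L c schwartz_measurable schwartz_decay] that by blast
  have "cm_integrable (point_sum L c) f" if "schwartz f" for f
    using cm_integral_point_sum(1)[OF L eq_measure_refl schwartz_measurable sw(1)] that by blast
  moreover have "cm_integral (point_sum L c) (\<lambda>x. a * f x + b * g x)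
      = a * cm_integral (point_sum L c) f + b * cm_integral (point_sum L c) g"
    if f: "schwartz f" and g: "schwartz g" for f g a b
  proof -
    have "((\<lambda>l. a * (c l * f l) + b * (c l * g l)) has_sum
        a * cm_integral (point_sum L c) f + b * cm_integral (point_sum L c) g) L"
      unfolding eq[OF f] eq[OF g] using sw(1)[OF f] sw(1)[OF g]
      by (intro has_sum_add has_sum_cmult_right has_sum_infsum)
    then have hs: "((\<lambda>l. c l * (a * f l + b * g l)) has_sum
        a * cm_integral (point_sum L c) f + b * cm_integral (point_sum L c) g) L"
      by (simp add: algebra_simps)
    have "(\<lambda>x. a * f x + b * g x) \<in> borel_measurable borel"
      using schwartz_measurable[OF f] schwartz_measurable[OF g] by simp
    from cm_integral_point_sum(2)[OF L eq_measure_refl this has_sum_imp_summable[OF hs]]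
    show ?thesis using infsumI[OF hs] by simp
  qed
  moreover have "cmod (cm_integral (point_sum L c) f) \<le>
      (\<Sum>\<^sub>\<infinity>l\<in>L. cmod (c l) / (1 + l\<^sup>2)) * (\<Sum>j\<le>2. \<Sum>k\<le>2. schwartz_seminorm j k f)"
    if f: "schwartz f" for f
  proof -
    have "schwartz_seminorm 0 0 f + schwartz_seminorm 2 0 f \<le> (\<Sum>j\<le>2. \<Sum>k\<le>2. schwartz_seminorm j k f)"
      using schwartz_seminorm_nonneg[OF f] by (simp add: numeral_2_eq_2 add_nonneg_nonneg add_increasing add_increasing2)
    then have "(schwartz_seminorm 0 0 f + schwartz_seminorm 2 0 f) * (\<Sum>\<^sub>\<infinity>l\<in>L. cmod (c l) / (1 + l\<^sup>2))
        \<le> (\<Sum>j\<le>2. \<Sum>k\<le>2. schwartz_seminorm j k f) * (\<Sum>\<^sub>\<infinity>l\<in>L. cmod (c l) / (1 + l\<^sup>2))"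
      by (intro mult_right_mono infsum_nonneg) auto
    then show ?thesis
      using sw(2)[OF f] unfolding eq[OF f] by (simp add: mult.commute)
  qed
  ultimately show ?thesis
    unfolding tempered_measure_def tempered_distribution_def
    using complex_measure_point_sum[OF L] by blast
qed

text \<open>Atoms are grouped by their floor. On a unit window the weight
  \<open>1 / (1 + l^2)\<close> is constant up to a factor 3 and the mass is at most
  \<open>B\<close>, so the series over integers \<open>k\<close> dominates.\<close>

lemma summable_on_window_bound:
  fixes c :: "real \<Rightarrow> complex"
  assumes L: "discrete_subset L" and B: "\<And>x. (\<Sum>l\<in>L \<inter> {x..x + 1}. cmod (c l)) \<le> B"
  shows "(\<lambda>l. cmod (c l) / (1 + l\<^sup>2)) summable_on L"
proof (rule nonneg_bdd_above_summable_on)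
  let ?w = "\<lambda>k::int. 1 / (1 + (real_of_int k)\<^sup>2)"
  show "bdd_above (sum (\<lambda>l. cmod (c l) / (1 + l\<^sup>2)) ` {F. F \<subseteq> L \<and> finite F})"
  proof (rule bdd_aboveI2)
    fix F assume "F \<in> {F. F \<subseteq> L \<and> finite F}"
    then have F: "F \<subseteq> L" "finite F" by auto
    have "(\<Sum>l\<in>F. cmod (c l) / (1 + l\<^sup>2))
        = (\<Sum>k\<in>floor ` F. \<Sum>l\<in>{l\<in>F. \<lfloor>l\<rfloor> = k}. cmod (c l) / (1 + l\<^sup>2))"
      using F by (intro sum.image_gen)
    also have "\<dots> \<le> (\<Sum>k\<in>floor ` F. 3 * B * ?w k)"
    proof (rule sum_mono)
      fix k :: int
      have "(\<Sum>l\<in>{l\<in>F. \<lfloor>l\<rfloor> = k}. cmod (c l) / (1 + l\<^sup>2)) \<le> (\<Sum>l\<in>{l\<in>F. \<lfloor>l\<rfloor> = k}. cmod (c l) * (3 * ?w k))"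
      proof (rule sum_mono)
        fix l assume "l \<in> {l\<in>F. \<lfloor>l\<rfloor> = k}"
        then have "\<bar>real_of_int k - l\<bar> \<le> 1" by (auto simp: abs_le_iff) linarith+
        from one_plus_square_le[OF this] have "1 / (1 + l\<^sup>2) \<le> 3 * ?w k"
          by (simp add: field_simps add_pos_nonneg)
        from mult_left_mono[OF this, of "cmod (c l)"] show "cmod (c l) / (1 + l\<^sup>2) \<le> cmod (c l) * (3 * ?w k)"
          by simp
      qed
      also have "\<dots> = (\<Sum>l\<in>{l\<in>F. \<lfloor>l\<rfloor> = k}. cmod (c l)) * (3 * ?w k)"
        by (rule sum_distrib_right[symmetric])
      also have "\<dots> \<le> (\<Sum>l\<in>L \<inter> {of_int k..of_int k + 1}. cmod (c l)) * (3 * ?w k)"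
        using F finite_discrete_Int_bounded[OF L, of "{real_of_int k..of_int k + 1}"]
        by (intro mult_right_mono sum_mono2) (auto simp: floor_eq_iff)
      also have "\<dots> \<le> B * (3 * ?w k)"
        by (intro mult_right_mono B) auto
      finally show "(\<Sum>l\<in>{l\<in>F. \<lfloor>l\<rfloor> = k}. cmod (c l) / (1 + l\<^sup>2)) \<le> 3 * B * ?w k" by (simp add: mult_ac)
    qed
    also have "\<dots> \<le> (\<Sum>\<^sub>\<infinity>k. 3 * B * ?w k)"
    proof (intro finite_sum_le_infsum summable_on_cmult_right summable_on_inverse_square_int)
      have "0 \<le> B" using B[of 0] by (rule order_trans[rotated]) (simp add: sum_nonneg)
      then show "0 \<le> 3 * B * ?w k" for k by simp
    qed (use F in auto)
    finally show "(\<Sum>l\<in>F. cmod (c l) / (1 + l\<^sup>2)) \<le> (\<Sum>\<^sub>\<infinity>k. 3 * B * ?w k)" .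
  qed
qed simp

section \<open>Images of the Dirac comb\<close>

lemma discrete_arithmetic_progression:
  assumes "arithmetic_progression P"
  shows "discrete_subset P"
proof -
  obtain a b where ab: "b > 0" "P = {a + b * of_int n | n :: int. True}"
    using assms by (auto simp: arithmetic_progression_def)
  have "finite (P \<inter> {u..v})" for u v
  proof (rule finite_subset)
    show "P \<inter> {u..v} \<subseteq> (\<lambda>n. a + b * of_int n) ` {\<lceil>(u - a) / b\<rceil>..\<lfloor>(v - a) / b\<rfloor>}"
      using ab by (auto simp: ceiling_le_iff le_floor_iff field_simps)
  qed simp
  then show ?thesis by (simp add: discrete_subset_def)
qed

lemma point_sum_vimage:
  assumes inj: "inj h" and L: "discrete_subset L" and hL: "discrete_subset (h ` L)"
    and A: "bounded A" "bounded (h -` A)"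
  shows "point_sum L c (h -` A) = point_sum (h ` L) (\<lambda>x. c (inv h x)) A"
proof -
  have "h ` L \<inter> A = h ` (L \<inter> h -` A)" by auto
  then have "sum (\<lambda>x. c (inv h x)) (h ` L \<inter> A) = sum c (L \<inter> h -` A)"
    using inj by (simp add: sum.reindex inj_on_subset)
  then show ?thesis
    using point_sum_bounded[OF L A(2)] point_sum_bounded[OF hL A(1)] by simp
qed

text \<open>Handles translation (\<open>t = 1\<close>) and dilation (\<open>r = 0\<close>) together.
  Preimages of bounded Borel sets under \<open>h\<close> must be shown bounded Borel again, because
  \<open>eq_measure\<close> says nothing about other sets.\<close>

lemma push_forward_affine:
  assumes \<mu>: "eq_measure \<mu> (point_sum P c)" and P: "arithmetic_progression P" and t: "t \<noteq> 0"
  shows "\<exists>P' c'. arithmetic_progression P' \<and> eq_measure (push_forward (\<lambda>x. t * x + r) \<mu>) (point_sum P' c')"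
proof -
  define h where "h x = t * x + r" for x
  obtain a b where ab: "b > 0" "P = {a + b * of_int n | n :: int. True}"
    using P by (auto simp: arithmetic_progression_def)
  have "h ` P = {h a + (\<bar>t\<bar> * b) * of_int n | n :: int. True}"
  proof (intro set_eqI iffI)
    fix x assume "x \<in> h ` P"
    then obtain n :: int where "x = h (a + b * of_int n)" using ab by auto
    \<comment> \<open>For negative \<open>t\<close> the index is reversed, which keeps the common
      difference positive.\<close>
    then have "x = h a + (\<bar>t\<bar> * b) * of_int (if t > 0 then n else - n)"
      by (auto simp: h_def algebra_simps)
    then show "x \<in> {h a + (\<bar>t\<bar> * b) * of_int n | n :: int. True}" by blast
  next
    fix x assume "x \<in> {h a + (\<bar>t\<bar> * b) * of_int n | n :: int. True}"
    then obtain n :: int where "x = h a + (\<bar>t\<bar> * b) * of_int n" by auto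
    then have "x = h (a + b * of_int (if t > 0 then n else - n))"
      by (auto simp: h_def algebra_simps)
    then show "x \<in> h ` P" using ab by blast
  qed
  then have ap: "arithmetic_progression (h ` P)"
    unfolding arithmetic_progression_def using ab(1) t by (metis mult_pos_pos zero_less_abs_iff)
  have inj: "inj h" using t by (auto simp: inj_def h_def)
  have "push_forward h \<mu> A = point_sum (h ` P) (\<lambda>x. c (inv h x)) A" if A: "A \<in> bounded_borel" for A
  proof -
    have m: "h -` A \<in> sets borel"
      using A measurable_sets_borel[of h borel A] by (simp add: bounded_borel_def h_def[abs_def])
    have "h -` A \<subseteq> (\<lambda>y. (1 / t) *\<^sub>R y + (- r / t)) ` A"
      using t by (auto simp: h_def image_iff field_simps intro!: bexI[where x = "t * _ + r"])
    moreover have "bounded ((\<lambda>y. (1 / t) *\<^sub>R y + (- r / t)) ` A)"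
    proof -
      have "bounded ((\<lambda>y. (- r / t) + y) ` (\<lambda>y. (1 / t) *\<^sub>R y) ` A)"
        using A by (intro bounded_translation bounded_scaling) (auto simp: bounded_borel_def)
      then show ?thesis by (simp add: image_image add.commute)
    qed
    ultimately have b: "bounded (h -` A)" by (rule bounded_subset[rotated])
    have "\<mu> (h -` A) = point_sum P c (h -` A)"
      using \<mu> m b by (simp add: eq_measure_def bounded_borel_def)
    then show ?thesis
      unfolding push_forward_def
      using point_sum_vimage[OF inj discrete_arithmetic_progression[OF P] discrete_arithmetic_progression[OF ap] _ b] A
      by (simp add: bounded_borel_def)
  qed
  then show ?thesis using ap unfolding eq_measure_def h_def[abs_def] by blast
qed

text \<open>The induction invariant records only that the atoms lie on a single progression and
  leaves the weights arbitrary: affine maps move the progression, modulation changes the weights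
  alone.\<close>

lemma comb_orbit_point_sum:
  assumes "comb_orbit \<mu>"
  shows "\<exists>P c. arithmetic_progression P \<and> eq_measure \<mu> (point_sum P c)"
  using assms
proof induction
  case comb
  have "arithmetic_progression \<int>"
    unfolding arithmetic_progression_def by (intro exI[of _ 0] exI[of _ 1]) (auto simp: Ints_def)
  then show ?case unfolding dirac_comb_def using eq_measure_refl by blast
next
  case (translate \<mu> r)
  then show ?case unfolding translation_def using push_forward_affine[of \<mu> _ _ 1 r] by auto
next
  case (dilate \<mu> t)
  then show ?case unfolding dilation_def using push_forward_affine[of \<mu> _ _ t 0] by auto
next
  case (modulate \<mu> a)
  then obtain P c where P: "arithmetic_progression P" and \<mu>: "eq_measure \<mu> (point_sum P c)" by blast
  note dP = discrete_arithmetic_progression[OF P]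
  define g where "g x = exp (2 * complex_of_real pi * \<i> * complex_of_real a * complex_of_real x)" for x
  have g: "g \<in> borel_measurable borel"
    unfolding g_def by (intro borel_measurable_continuous_onI continuous_intros)
  have "mult_measure g \<mu> A = point_sum P (\<lambda>x. c x * g x) A" if "A \<in> bounded_borel" for A
  proof -
    have A: "bounded A" "A \<in> sets borel" using that by (auto simp: bounded_borel_def)
    have fin: "finite (P \<inter> A)" by (rule finite_discrete_Int_bounded[OF dP A(1)])
    have m: "(\<lambda>x. indicator A x * g x) \<in> borel_measurable borel" using g A(2) by simp
    \<comment> \<open>A bounded Borel set meets \<open>P\<close> in finitely many points, so the
      integral defining the modulated measure is a finite sum.\<close>
    have hs: "((\<lambda>l. c l * (indicator A l * g l)) has_sum (\<Sum>l\<in>P \<inter> A. c l * g l)) P"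
    proof -
      have "((\<lambda>l. c l * g l) has_sum (\<Sum>l\<in>P \<inter> A. c l * g l)) (P \<inter> A)"
        using fin by simp
      then show ?thesis
        by (rule has_sum_cong_neutral[THEN iffD1, rotated -1]) (auto simp: indicator_def)
    qed
    show ?thesis
      unfolding mult_measure_def cm_integral_point_sum(2)[OF dP \<mu> m has_sum_imp_summable[OF hs]]
      using infsumI[OF hs] point_sum_bounded[OF dP A(1)] by simp
  qed
  then show ?case unfolding modulation_def eq_measure_def g_def[abs_def] using P by blast
qed

text \<open>Evaluation on a singleton: a nonzero mass at \<open>l\<close> must come from at least
  one term, whose progression then contains \<open>l\<close>.\<close>

lemma finitely_poisson_derived_point_sum:
  assumes "finitely_poisson_derived (point_sum L c)" and c: "\<And>l. l \<in> L \<Longrightarrow> c l \<noteq> 0"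
  shows "in_finite_union_of_APs L"
proof -
  obtain n :: nat and a \<mu> where o: "\<And>i. i < n \<Longrightarrow> comb_orbit (\<mu> i)"
    and eq: "eq_measure (point_sum L c) (\<lambda>A. \<Sum>i<n. a i * \<mu> i A)"
    using assms(1) unfolding finitely_poisson_derived_def by blast
  have "\<forall>i. \<exists>P. i < n \<longrightarrow> (\<exists>d. arithmetic_progression P \<and> eq_measure (\<mu> i) (point_sum P d))"
    using comb_orbit_point_sum o by blast
  then obtain P where P: "\<And>i. i < n \<Longrightarrow> \<exists>d. arithmetic_progression (P i) \<and> eq_measure (\<mu> i) (point_sum (P i) d)"
    by metis
  have "L \<subseteq> \<Union>(P ` {..<n})"
  proof
    fix l assume l: "l \<in> L"
    have "(\<Sum>i<n. a i * \<mu> i {l}) = point_sum L c {l}"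
      using eq singleton_bounded_borel by (simp add: eq_measure_def)
    also have "\<dots> \<noteq> 0" using l c by (simp add: point_sum_singleton)
    finally obtain i where i: "i < n" "\<mu> i {l} \<noteq> 0"
      by (metis (no_types, lifting) lessThan_iff mult_zero_right sum.neutral)
    obtain d where "eq_measure (\<mu> i) (point_sum (P i) d)" using P[OF i(1)] by blast
    then have "l \<in> P i"
      using i(2) singleton_bounded_borel[of l]
      by (auto simp: eq_measure_def point_sum_singleton split: if_splits)
    then show "l \<in> \<Union>(P ` {..<n})" using i by blast
  qed
  then show ?thesis
    unfolding in_finite_union_of_APs_def using P by (intro exI[of _ "P ` {..<n}"]) auto
qed

section \<open>Poisson summation\<close>

lemma integrable_inverse_one_plus_square:
  "integrable lborel (\<lambda>x::real. C / (1 + x\<^sup>2))"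
proof -
  have "set_integrable lborel (einterval (-\<infinity>) \<infinity>) (\<lambda>x. inverse (1 + x^2))"
    by (rule integrable_inverse_1_plus_square)
  then have "integrable lborel (\<lambda>x::real. inverse (1 + x\<^sup>2))"
    by (simp add: set_integrable_def)
  then show ?thesis by (simp add: divide_inverse)
qed

lemma integrable_decay:
  fixes f :: "real \<Rightarrow> complex"
  assumes "f \<in> borel_measurable borel" "\<And>x. cmod (f x) \<le> C / (1 + x\<^sup>2)"
  shows "integrable lborel f"
  by (rule Bochner_Integration.integrable_bound[OF integrable_inverse_one_plus_square[of C]])
    (use assms order_trans[OF assms(2) abs_ge_self] in auto)

section \<open>Decay of Fourier transforms\<close>

lemma fourier_cis: "fourier f \<xi> = (LINT x|lborel. cis (- 2 * pi * \<xi> * x) * f x)"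
  unfolding fourier_def cis_conv_exp by (simp add: mult_ac)

lemma borel_measurable_cis [measurable]: "cis \<in> borel_measurable borel"
  by (intro borel_measurable_continuous_onI continuous_intros)

lemma integrable_cis_mult:
  fixes f :: "real \<Rightarrow> complex"
  assumes "f \<in> borel_measurable borel" "\<And>x. cmod (f x) \<le> C / (1 + x\<^sup>2)"
  shows "integrable lborel (\<lambda>x. cis (a * x) * f x)"
  using assms by (intro integrable_decay[where C=C]) (auto simp: norm_mult)

lemma fourier_measurable:
  assumes [measurable]: "f \<in> borel_measurable borel"
  shows "fourier f \<in> borel_measurable borel"
proof -
  have "(\<lambda>\<xi>. LINT x|lborel. cis (- 2 * pi * \<xi> * x) * f x) \<in> borel_measurable borel"
    by measurable
  then show ?thesis by (simp add: fourier_cis[abs_def])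
qed

lemma decay_tendsto_0:
  fixes f :: "real \<Rightarrow> complex"
  assumes "\<And>x. cmod (f x) \<le> C / (1 + x\<^sup>2)"
  shows "(f \<longlongrightarrow> 0) at_top" "(f \<longlongrightarrow> 0) at_bot"
proof -
  have "((\<lambda>x::real. C / (1 + x\<^sup>2)) \<longlongrightarrow> 0) at_top" "((\<lambda>x::real. C / (1 + x\<^sup>2)) \<longlongrightarrow> 0) at_bot"
    by real_asymp+
  then show "(f \<longlongrightarrow> 0) at_top" "(f \<longlongrightarrow> 0) at_bot"
    by (auto intro: Lim_null_comparison[OF always_eventually, rule_format, OF assms])
qed

lemma integral_derivative_eq_0:
  fixes F :: "real \<Rightarrow> complex"
  assumes F: "\<And>x. (F has_vector_derivative f x) (at x)" and f: "\<And>x. isCont f x"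
    and "integrable lborel f" and lim: "(F \<longlongrightarrow> 0) at_top" "(F \<longlongrightarrow> 0) at_bot"
  shows "integral\<^sup>L lborel f = 0"
proof -
  have "(LBINT x=-\<infinity>..\<infinity>. f x) = 0 - 0"
  proof (rule interval_integral_FTC_integrable)
    show "((F \<circ> real_of_ereal) \<longlongrightarrow> 0) (at_right (- \<infinity>))"
      using lim by (simp add: at_right_MInf filterlim_filtermap comp_def)
    show "((F \<circ> real_of_ereal) \<longlongrightarrow> 0) (at_left \<infinity>)"
      using lim by (simp add: at_left_PInf filterlim_filtermap comp_def)
    show "set_integrable lborel (einterval (- \<infinity>) \<infinity>) f"
      using assms(3) by (simp add: set_integrable_def)
  qed (use F f in auto)
  then show ?thesis
    by (simp add: interval_lebesgue_integral_def set_lebesgue_integral_def)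
qed

lemma has_vector_derivative_cis:
  "((\<lambda>x. cis (a * x)) has_vector_derivative (\<i> * of_real a * cis (a * x))) (at x)"
  unfolding has_vector_derivative_def
  by (auto intro!: derivative_eq_intros simp: scaleR_conv_of_real mult_ac)

text \<open>Integration by parts, phrased as the vanishing of the integral of the derivative of
  \<open>cis (?a * x) * f x\<close>, whose boundary values are 0 by decay.\<close>

lemma fourier_deriv:
  assumes f: "\<And>x. (f has_vector_derivative f' x) (at x)" and f': "\<And>x. isCont f' x"
    and d: "\<And>x. cmod (f x) \<le> C / (1 + x\<^sup>2)" and d': "\<And>x. cmod (f' x) \<le> C / (1 + x\<^sup>2)"
  shows "fourier f' \<xi> = 2 * pi * \<i> * \<xi> * fourier f \<xi>"
proof -
  let ?a = "- 2 * pi * \<xi>"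
  have c: "isCont f x" for x using f has_vector_derivative_continuous by blast
  have m: "f \<in> borel_measurable borel" "f' \<in> borel_measurable borel"
    using c f' by (auto intro!: borel_measurable_continuous_onI continuous_at_imp_continuous_on)
  note i = integrable_cis_mult[OF m(1) d, of ?a] integrable_cis_mult[OF m(2) d', of ?a]
  let ?g = "\<lambda>x. \<i> * of_real ?a * (cis (?a * x) * f x) + cis (?a * x) * f' x"
  have "integral\<^sup>L lborel ?g = 0"
  proof (rule integral_derivative_eq_0)
    fix x
    show "((\<lambda>x. cis (?a * x) * f x) has_vector_derivative ?g x) (at x)"
      using has_vector_derivative_mult[OF has_vector_derivative_cis f, of ?a x] by (simp add: algebra_simps)
    show "isCont ?g x"
      using f' c has_vector_derivative_continuous[OF has_vector_derivative_cis, of x ?a] by (intro continuous_intros) auto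
    show "integrable lborel ?g" using i by auto
    have "cmod (cis (?a * x) * f x) \<le> C / (1 + x\<^sup>2)" for x using d by (simp add: norm_mult)
    from decay_tendsto_0[OF this]
    show "((\<lambda>x. cis (?a * x) * f x) \<longlongrightarrow> 0) at_top" "((\<lambda>x. cis (?a * x) * f x) \<longlongrightarrow> 0) at_bot" by auto
  qed
  moreover have "integral\<^sup>L lborel ?g = \<i> * of_real ?a * fourier f \<xi> + fourier f' \<xi>"
    using i by (simp add: fourier_cis)
  ultimately show ?thesis by (simp add: algebra_simps eq_neg_iff_add_eq_0)
qed

lemma cmod_fourier_le:
  assumes "\<And>x. cmod (f x) \<le> C / (1 + x\<^sup>2)" "f \<in> borel_measurable borel"
  shows "cmod (fourier f \<xi>) \<le> (LINT x|lborel. C / (1 + x\<^sup>2))"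
  unfolding fourier_cis
  by (rule order_trans[OF integral_norm_bound integral_mono])
    (use assms integrable_inverse_one_plus_square integrable_cis_mult[OF assms(2,1)] integrable_decay[OF assms(2,1)] in \<open>auto simp: norm_mult\<close>)

text \<open>The transform of the second derivative is bounded and equals the transform of
  \<open>f\<close> times \<open>(2 * pi * \<i> * \<xi>)^2\<close>; adding the bound for
  \<open>f\<close> itself gives the weight \<open>1 + \<xi>^2\<close>.\<close>

lemma fourier_schwartz_decay:
  assumes f: "schwartz f"
  obtains C where "\<And>\<xi>. cmod (fourier f \<xi>) \<le> C / (1 + \<xi>\<^sup>2)"
proof -
  define C where "C = (\<Sum>k\<le>2. schwartz_seminorm 0 k f + schwartz_seminorm 2 k f)"
  have D: "cmod (nderiv k f x) \<le> C / (1 + x\<^sup>2)" if "k \<le> 2" for k x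
  proof -
    have "schwartz_seminorm 0 k f + schwartz_seminorm 2 k f \<le> C"
      unfolding C_def using that schwartz_seminorm_nonneg[OF f] by (intro member_le_sum) (auto intro: add_nonneg_nonneg)
    then show ?thesis
      using schwartz_nderiv_decay[OF f, of k x] by (meson divide_right_mono order_trans zero_le_power2 add_nonneg_nonneg zero_le_one)
  qed
  have df: "nderiv k f differentiable (at x)" for k x using f by (simp add: schwartz_def)
  then have vd: "(nderiv k f has_vector_derivative nderiv (Suc k) f x) (at x)" for k x
    by (simp add: nderiv_def vector_derivative_works[symmetric])
  have c: "isCont (nderiv k f) x" for k x using df differentiable_imp_continuous_within by blast
  have m: "nderiv k f \<in> borel_measurable borel" for k
    using c by (auto intro!: borel_measurable_continuous_onI continuous_at_imp_continuous_on)
  have n0: "nderiv 0 f = f" by (simp add: nderiv_def)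
  let ?I = "LINT x|lborel. C / (1 + x\<^sup>2)"
  have 0: "cmod (fourier f \<xi>) \<le> ?I" for \<xi> using cmod_fourier_le[OF D m, of 0] by (simp add: n0)
  have 2: "cmod (fourier (nderiv 2 f) \<xi>) \<le> ?I" for \<xi> by (rule cmod_fourier_le[OF D m]) simp
  have "fourier (nderiv 2 f) \<xi> = (2 * pi * \<i> * \<xi>) * ((2 * pi * \<i> * \<xi>) * fourier f \<xi>)" for \<xi>
    using fourier_deriv[OF vd c D D, of 1 \<xi>] fourier_deriv[OF vd c D D, of 0 \<xi>]
    by (simp add: numeral_2_eq_2 n0)
  then have "cmod (fourier (nderiv 2 f) \<xi>) = (2 * pi)\<^sup>2 * (\<xi>\<^sup>2 * cmod (fourier f \<xi>))" for \<xi>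
    by (simp add: norm_mult power2_eq_square mult_ac)
  then have 3: "(2 * pi)\<^sup>2 * (\<xi>\<^sup>2 * cmod (fourier f \<xi>)) \<le> ?I" for \<xi> using 2 by metis
  have "cmod (fourier f \<xi>) \<le> (2 * ?I) / (1 + \<xi>\<^sup>2)" for \<xi>
  proof -
    have "1 * (\<xi>\<^sup>2 * cmod (fourier f \<xi>)) \<le> (2 * pi)\<^sup>2 * (\<xi>\<^sup>2 * cmod (fourier f \<xi>))"
      by (intro mult_right_mono one_le_power) (use pi_gt3 in auto)
    then have "(1 + \<xi>\<^sup>2) * cmod (fourier f \<xi>) \<le> 2 * ?I" using 0[of \<xi>] 3[of \<xi>] by (simp add: algebra_simps)
    then show ?thesis by (simp add: field_simps add_pos_nonneg)
  qed
  then show ?thesis by (rule that)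
qed

text \<open>Translating by \<open>1 / (2\<xi>)\<close> changes the sign of the exponential.\<close>

lemma riemann_lebesgue_decay:
  fixes G :: "real \<Rightarrow> complex"
  assumes m[measurable]: "G \<in> borel_measurable borel" and d: "\<And>x. cmod (G x) \<le> C / (1 + x\<^sup>2)"
    and c: "AE x in lborel. isCont G x" and \<xi>: "filterlim (\<lambda>n. \<bar>\<xi> n\<bar>) at_top sequentially"
  shows "(\<lambda>n. fourier G (\<xi> n)) \<longlonglongrightarrow> 0"
proof -
  \<comment> \<open>The default 0 at small frequencies keeps \<open>\<bar>s n\<bar> \<le> 1\<close>
    for every \<open>n\<close>, so a single dominating function serves all translates.\<close>
  define s where "s n = (if \<bar>\<xi> n\<bar> \<ge> 1 then 1 / (2 * \<xi> n) else 0)" for n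
  have ev: "eventually (\<lambda>n. \<bar>\<xi> n\<bar> \<ge> 1) sequentially"
    using \<xi> by (simp add: filterlim_at_top)
  have s1: "\<bar>s n\<bar> \<le> 1" for n by (auto simp: s_def abs_mult field_simps)
  have s0: "s \<longlonglongrightarrow> 0"
  proof (rule tendsto_rabs_zero_cancel, rule tendsto_cong[THEN iffD1])
    show "(\<lambda>n. inverse \<bar>\<xi> n\<bar> * (1/2)) \<longlonglongrightarrow> 0"
      using tendsto_inverse_0_at_top[OF \<xi>] by (rule tendsto_mult_left_zero)
    show "\<forall>\<^sub>F n in sequentially. inverse \<bar>\<xi> n\<bar> * (1/2) = \<bar>s n\<bar>"
      using ev by eventually_elim (auto simp: s_def field_simps abs_mult)
  qed
  have C0: "0 \<le> C" using order_trans[OF norm_ge_zero d, of 0] by simp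
  have d': "cmod (G (x + s n)) \<le> 3 * C / (1 + x\<^sup>2)" for x n
  proof -
    have "1 + x\<^sup>2 \<le> 3 * (1 + (x + s n)\<^sup>2)" using s1[of n] by (intro one_plus_square_le) simp
    then have "C / (1 + (x + s n)\<^sup>2) \<le> 3 * C / (1 + x\<^sup>2)"
      using C0 mult_left_mono[of "1 + x\<^sup>2" "3 * (1 + (x + s n)\<^sup>2)" C] by (simp add: field_simps add_pos_nonneg)
    then show ?thesis using d order_trans by blast
  qed
  have "(\<lambda>n. LINT x|lborel. cmod (G x - G (x + s n))) \<longlonglongrightarrow> (LINT x::real|lborel. (0::real))"
  proof (rule integral_dominated_convergence)
    show "integrable lborel (\<lambda>x. 4 * C / (1 + x\<^sup>2))" by (rule integrable_inverse_one_plus_square)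
    show "AE x in lborel. (\<lambda>n. cmod (G x - G (x + s n))) \<longlonglongrightarrow> 0"
      using c
    proof eventually_elim
      case (elim x)
      have "(\<lambda>n. x + s n) \<longlonglongrightarrow> x + 0" by (intro tendsto_intros s0)
      then have "(\<lambda>n. G (x + s n)) \<longlonglongrightarrow> G x" using elim isCont_tendsto_compose by fastforce
      then have "(\<lambda>n. cmod (G x - G (x + s n))) \<longlonglongrightarrow> cmod (G x - G x)" by (intro tendsto_intros)
      then show ?case by simp
    qed
    show "AE x in lborel. norm (cmod (G x - G (x + s n))) \<le> 4 * C / (1 + x\<^sup>2)" for n
    proof (rule AE_I2)
      fix x
      have "cmod (G x - G (x + s n)) \<le> C / (1 + x\<^sup>2) + 3 * C / (1 + x\<^sup>2)"
        using norm_triangle_ineq4[of "G x" "G (x + s n)"] d[of x] d'[of x n] by linarith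
      then show "norm (cmod (G x - G (x + s n))) \<le> 4 * C / (1 + x\<^sup>2)" by (simp add: add_divide_distrib[symmetric])
    qed
  qed simp_all
  then have lim: "(\<lambda>n. LINT x|lborel. cmod (G x - G (x + s n))) \<longlonglongrightarrow> 0" by simp
  show ?thesis
  proof (rule Lim_null_comparison[OF _ lim])
    show "\<forall>\<^sub>F n in sequentially. cmod (fourier G (\<xi> n)) \<le> (LINT x|lborel. cmod (G x - G (x + s n)))"
      using ev
    proof eventually_elim
      case (elim n)
      have \<xi>s: "\<xi> n * s n = 1 / 2" using elim by (auto simp: s_def)
      let ?e = "\<lambda>x. cis (- 2 * pi * \<xi> n * x)"
      have sh: "?e (s n + 1 * x) = - ?e x" for x
      proof -
        have "- 2 * pi * \<xi> n * (s n + 1 * x) = - pi + (- 2 * pi * \<xi> n * x)"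
          using \<xi>s by (simp add: algebra_simps)
        moreover have "cis (- pi + t) = - cis t" for t
          by (simp add: complex_eq_iff cos_add sin_add)
        ultimately show ?thesis by metis
      qed
      have "fourier G (\<xi> n) = (LINT x|lborel. ?e (s n + 1 * x) * G (s n + 1 * x))"
        unfolding fourier_cis by (subst lborel_integral_real_affine[where c=1 and t="s n"]) auto
      also have "\<dots> = (LINT x|lborel. - (?e x * G (x + s n)))"
        unfolding sh by (simp add: add.commute)
      finally have e2: "fourier G (\<xi> n) = - (LINT x|lborel. ?e x * G (x + s n))" by simp
      have i1: "integrable lborel (\<lambda>x. ?e x * G x)"
        by (rule integrable_cis_mult[OF m d])
      have i2: "integrable lborel (\<lambda>x. ?e x * G (x + s n))"
        by (rule integrable_cis_mult[OF _ d']) measurable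
      \<comment> \<open>Averages the original integral with its sign-reversed translate; what
        remains is an L1 modulus of continuity, already shown to tend to 0.\<close>
      have "2 * fourier G (\<xi> n) = (LINT x|lborel. ?e x * (G x - G (x + s n)))"
        using i1 i2 e2 by (simp add: fourier_cis right_diff_distrib)
      then have "2 * cmod (fourier G (\<xi> n)) = cmod (LINT x|lborel. ?e x * (G x - G (x + s n)))"
        by (metis norm_mult norm_numeral)
      also have "\<dots> \<le> (LINT x|lborel. cmod (?e x * (G x - G (x + s n))))" by (rule integral_norm_bound)
      also have "\<dots> = (LINT x|lborel. cmod (G x - G (x + s n)))" by (simp add: norm_mult)
      finally have "2 * cmod (fourier G (\<xi> n)) \<le> (LINT x|lborel. cmod (G x - G (x + s n)))" .
      then show ?case using norm_ge_zero[of "fourier G (\<xi> n)"] by linarith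
    qed
  qed
qed

text \<open>Jordan's inequality: on \<open>{0..pi / 2}\<close> the sine is concave and so lies above
  its chord.\<close>

lemma sin_pi_ge:
  assumes "0 \<le> t" "t \<le> 1 / 2"
  shows "2 * t \<le> sin (pi * t)"
proof -
  have "convex_on {0..pi / 2} (\<lambda>x. - sin x)"
    by (rule f''_ge0_imp_convex[where f'="\<lambda>x. - cos x" and f''="\<lambda>x. sin x"])
      (auto intro!: derivative_eq_intros sin_ge_zero)
  from convex_onD[OF this, of "2 * t" 0 "pi / 2"] assms
  show ?thesis by (simp add: mult.commute)
qed

text \<open>The chord has length \<open>2 * sin (pi * t)\<close> at distance \<open>t\<close> from
  the nearest integer. The zeros of this denominator are thus simple, with a uniform constant, and a
  function that vanishes linearly at the integers can be divided by it.\<close>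

lemma cmod_cis_diff_1_ge:
  assumes "\<bar>x - of_int n\<bar> \<le> 1 / 2"
  shows "4 * \<bar>x - of_int n\<bar> \<le> cmod (cis (2 * pi * x) - 1)"
proof -
  let ?t = "x - of_int n"
  have "cis (2 * pi * x) = cis (2 * pi * ?t + 2 * pi * of_int n)" by (simp add: algebra_simps)
  also have "\<dots> = cis (2 * pi * ?t)"
    by (simp only: cis_mult[symmetric] cis_multiple_2pi Ints_of_int mult_1_right)
  also have "\<dots> = exp (\<i> * of_real (2 * pi * ?t))" by (rule cis_conv_exp)
  finally have "cis (2 * pi * x) = exp (\<i> * of_real (2 * pi * ?t))" .
  then have "cmod (cis (2 * pi * x) - 1) = 2 * \<bar>sin ((2 * pi * ?t) / 2)\<bar>"
    by (simp only: dist_exp_i_1)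
  also have "(2 * pi * ?t) / 2 = pi * ?t" by simp
  also have "\<bar>sin (pi * t)\<bar> = \<bar>sin (pi * \<bar>t\<bar>)\<bar>" for t
    by (cases "0 \<le> t") auto
  finally have "cmod (cis (2 * pi * x) - 1) = 2 * \<bar>sin (pi * \<bar>?t\<bar>)\<bar>" .
  then show ?thesis using sin_pi_ge[of "\<bar>?t\<bar>"] assms by linarith
qed

text \<open>Symmetric intervals eventually contain every finite set of integers; this connects
  unordered sums with the telescoping partial sums in \<open>poisson_summation\<close>.\<close>

lemma sum_symmetric_int_tendsto:
  fixes g :: "int \<Rightarrow> complex"
  assumes "g summable_on UNIV"
  shows "(\<lambda>N. \<Sum>k=-int N..int N. g k) \<longlonglongrightarrow> infsum g UNIV"
proof -
  have "(sum g \<longlongrightarrow> infsum g UNIV) (finite_subsets_at_top UNIV)"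
    using has_sum_infsum[OF assms] by (simp add: has_sum_def)
  moreover have "filterlim (\<lambda>N. {-int N..int N}) (finite_subsets_at_top UNIV) sequentially"
    unfolding filterlim_finite_subsets_at_top
  proof (intro allI impI)
    fix X :: "int set" assume "finite X \<and> X \<subseteq> UNIV"
    then have X: "finite (insert 0 (abs ` X))" by simp
    define M where "M = nat (Max (insert 0 (abs ` X)))"
    have "\<bar>x\<bar> \<le> int M" if "x \<in> X" for x
    proof -
      have "\<bar>x\<bar> \<le> Max (insert 0 (abs ` X))" using that by (intro Max_ge[OF X]) auto
      then show ?thesis unfolding M_def by linarith
    qed
    then have "finite {-int N..int N} \<and> X \<subseteq> {-int N..int N} \<and> {-int N..int N} \<subseteq> UNIV" if "M \<le> N" for N
      using that by (fastforce simp: abs_le_iff)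
    then show "\<forall>\<^sub>F N in sequentially. finite {-int N..int N} \<and> X \<subseteq> {-int N..int N} \<and> {-int N..int N} \<subseteq> UNIV"
      unfolding eventually_sequentially by blast
  qed
  ultimately show ?thesis by (rule filterlim_compose)
qed

text \<open>Orthogonality of the characters: the antiderivative takes equal values at
  \<open>a\<close> and \<open>a + 1\<close>, since their arguments differ by a multiple of
  \<open>2 * pi\<close>.\<close>

lemma integral_cis_unit_interval:
  "(LINT x|lborel. indicator {a..<a + 1} x * cis (- 2 * pi * of_int k * x)) = (if k = 0 then 1 else 0)"
proof (cases "k = 0")
  case True
  then show ?thesis
    by (simp add: of_real_indicator[symmetric, where 'a=complex] del: of_real_indicator)
next
  case False
  let ?a = "- 2 * pi * of_int k"
  let ?F = "\<lambda>x. cis (?a * x) / (\<i> * of_real ?a)"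
  have "(LBINT x=a..a+1. cis (?a * x)) = ?F (a + 1) - ?F a"
  proof (rule interval_integral_FTC_finite)
    show "continuous_on {min a (a + 1)..max a (a + 1)} (\<lambda>x. cis (?a * x))" by (intro continuous_intros)
    fix x
    have "(?F has_vector_derivative \<i> * of_real ?a * cis (?a * x) / (\<i> * of_real ?a)) (at x)"
      by (intro has_vector_derivative_divide has_vector_derivative_cis)
    then show "(?F has_vector_derivative cis (?a * x)) (at x within {min a (a + 1)..max a (a + 1)})"
      using False by (simp add: has_vector_derivative_at_within)
  qed
  also have "cis (?a * (a + 1)) = cis (?a * a + 2 * pi * of_int (- k))" by (simp add: algebra_simps)
  also have "\<dots> = cis (?a * a)" by (simp only: cis_mult[symmetric] cis_multiple_2pi Ints_of_int mult_1_right)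
  finally have "(LBINT x=a..a+1. cis (?a * x)) = 0" by simp
  then have "(LBINT x:{a..<a+1}. cis (?a * x)) = 0" by (simp add: interval_integral_Ico)
  then show ?thesis using False
    by (simp add: set_lebesgue_integral_def scaleR_conv_of_real of_real_indicator)
qed

lemma half_open_window_floor:
  "x \<in> {real_of_int n - 1 / 2..<real_of_int n - 1 / 2 + 1} \<longleftrightarrow> \<lfloor>x + 1 / 2\<rfloor> = n"
  by (auto simp: floor_eq_iff)

lemma abs_diff_floor_half: "\<bar>x - of_int \<lfloor>x + 1 / 2\<rfloor>\<bar> \<le> 1 / (2::real)"
  using floor_correct[of "x + 1 / 2"] by linarith

lemma decay_near:
  assumes "0 \<le> C" "\<bar>x - y\<bar> \<le> 1"
  shows "C / (1 + y\<^sup>2) \<le> 3 * C / (1 + (x::real)\<^sup>2)"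
  using mult_left_mono[OF one_plus_square_le[OF assms(2)] assms(1)]
  by (simp add: field_simps add_pos_nonneg)

lemma summable_on_decay_int:
  fixes f :: "real \<Rightarrow> complex"
  assumes "\<And>x. cmod (f x) \<le> C / (1 + x\<^sup>2)"
  shows "(\<lambda>n::int. f (of_int n)) summable_on UNIV"
proof -
  have "(\<lambda>k::int. C * (1 / (1 + (real_of_int k)\<^sup>2))) summable_on UNIV"
    by (intro summable_on_cmult_right summable_on_inverse_square_int)
  then have "(\<lambda>n::int. cmod (f (of_int n))) summable_on UNIV"
    by (rule summable_on_comparison_test) (use assms in auto)
  then show ?thesis by (rule abs_summable_summable)
qed

text \<open>The step function interpolating \<open>f\<close> at the integers satisfies the Poisson summation formula
  trivially: its Fourier transform vanishes at all nonzero integers.\<close>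

lemma fourier_step_function:
  fixes f :: "real \<Rightarrow> complex"
  assumes m[measurable]: "f \<in> borel_measurable borel" and d: "\<And>x. cmod (f x) \<le> C / (1 + x\<^sup>2)"
  shows "fourier (\<lambda>x. f (of_int \<lfloor>x + 1 / 2\<rfloor>)) (of_int k) = (if k = 0 then (\<Sum>\<^sub>\<infinity>n::int. f (of_int n)) else 0)"
proof -
  let ?L = "\<lambda>x. f (of_int \<lfloor>x + 1 / 2\<rfloor>)"
  let ?e = "\<lambda>x. cis (- 2 * pi * of_int k * x)"
  let ?I = "\<lambda>n::int. {real_of_int n - 1 / 2..<real_of_int n - 1 / 2 + 1}"
  let ?s = "\<lambda>N x. \<Sum>n=-int N..int N. f (of_int n) * (indicator (?I n) x * ?e x)"
  have C0: "0 \<le> C" using order_trans[OF norm_ge_zero d, of 0] by simp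
  have dL: "cmod (?L x) \<le> 3 * C / (1 + x\<^sup>2)" for x
    using decay_near[OF C0, of x "of_int \<lfloor>x + 1 / 2\<rfloor>"] abs_diff_floor_half[of x] d[of "of_int \<lfloor>x + 1 / 2\<rfloor>"] by linarith
  have s: "?s N x = (if \<bar>\<lfloor>x + 1 / 2\<rfloor>\<bar> \<le> int N then ?e x * ?L x else 0)" for N x
  proof -
    \<comment> \<open>The half-open windows partition the line, so at most one summand is nonzero at
      \<open>x\<close>.\<close>
    have "?s N x = (\<Sum>n=-int N..int N. if \<lfloor>x + 1 / 2\<rfloor> = n then f (of_int n) * ?e x else 0)"
      unfolding indicator_def half_open_window_floor by (intro sum.cong refl) auto
    then show ?thesis by (auto simp: abs_le_iff)
  qed
  have "(\<lambda>N. LINT x|lborel. ?s N x) \<longlonglongrightarrow> (LINT x|lborel. ?e x * ?L x)"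
  proof (rule integral_dominated_convergence)
    show "integrable lborel (\<lambda>x. 3 * C / (1 + x\<^sup>2))" by (rule integrable_inverse_one_plus_square)
    show "AE x in lborel. (\<lambda>N. ?s N x) \<longlonglongrightarrow> ?e x * ?L x"
    proof (intro AE_I2 tendsto_eventually)
      fix x :: real
      show "\<forall>\<^sub>F N in sequentially. ?s N x = ?e x * ?L x"
        unfolding eventually_sequentially s by (intro exI[of _ "nat \<bar>\<lfloor>x + 1 / 2\<rfloor>\<bar>"]) auto
    qed
    show "AE x in lborel. norm (?s N x) \<le> 3 * C / (1 + x\<^sup>2)" for N
      unfolding s using dL C0 by (intro AE_I2) (auto simp: norm_mult)
  qed (measurable)
  moreover have "(LINT x|lborel. ?s N x) = (\<Sum>n=-int N..int N. if k = 0 then f (of_int n) else 0)" for N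
  proof -
    have i: "integrable lborel (\<lambda>x. indicator (?I n) x * ?e x)" for n
    proof (rule Bochner_Integration.integrable_bound)
      show "integrable lborel (indicator (?I n) :: real \<Rightarrow> real)" by (intro integrable_real_indicator) auto
    qed (auto simp: norm_mult indicator_def)
    show ?thesis
      using i integral_cis_unit_interval[of "real_of_int _ - 1 / 2" k]
      by (subst Bochner_Integration.integral_sum) (auto intro!: sum.cong)
  qed
  ultimately have "(\<lambda>N. \<Sum>n=-int N..int N. if k = 0 then f (of_int n) else 0) \<longlonglongrightarrow> fourier ?L (of_int k)"
    unfolding fourier_cis by simp
  moreover have "(\<lambda>N. \<Sum>n=-int N..int N. if k = 0 then f (of_int n) else 0) \<longlonglongrightarrow>
      (\<Sum>\<^sub>\<infinity>n::int. if k = 0 then f (of_int n) else 0)"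
    by (rule sum_symmetric_int_tendsto) (use summable_on_decay_int[OF d] in \<open>cases "k = 0"; simp\<close>)
  ultimately have "fourier ?L (of_int k) = (\<Sum>\<^sub>\<infinity>n::int. if k = 0 then f (of_int n) else 0)"
    by (rule LIMSEQ_unique)
  then show ?thesis by simp
qed

text \<open>After subtracting the step function, \<open>f - L\<close> vanishes at the integers and can be divided by
  \<open>e\<^sup>2\<^sup>\<pi>\<^sup>i\<^sup>x - 1\<close>. Its Fourier coefficients are then differences of consecutive coefficients of the quotient
  and telescope to \<open>0\<close> by the Riemann-Lebesgue lemma.\<close>

lemma poisson_summation:
  fixes f :: "real \<Rightarrow> complex"
  assumes f: "\<And>x. (f has_vector_derivative f' x) (at x)"
    and d: "\<And>x. cmod (f x) \<le> C / (1 + x\<^sup>2)" and d': "\<And>x. cmod (f' x) \<le> C / (1 + x\<^sup>2)"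
    and sm: "(\<lambda>k::int. fourier f (of_int k)) summable_on UNIV"
  shows "(\<Sum>\<^sub>\<infinity>n::int. f (of_int n)) = (\<Sum>\<^sub>\<infinity>k::int. fourier f (of_int k))"
proof -
  have c: "isCont f x" for x using f has_vector_derivative_continuous by blast
  have m[measurable]: "f \<in> borel_measurable borel"
    using c by (auto intro!: borel_measurable_continuous_onI continuous_at_imp_continuous_on)
  have C0: "0 \<le> C" using order_trans[OF norm_ge_zero d, of 0] by simp
  define L where "L x = f (of_int \<lfloor>x + 1 / 2\<rfloor>)" for x :: real
  \<comment> \<open>At an integer the quotient is 0 / 0, which evaluates to 0; the numerator
    vanishes there too, so \<open>dG\<close> and \<open>uG\<close> hold at every point.\<close>
  define G where "G x = (f x - L x) / (cis (2 * pi * x) - 1)" for x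
  have mL[measurable]: "L \<in> borel_measurable borel" unfolding L_def by measurable
  have mG[measurable]: "G \<in> borel_measurable borel" unfolding G_def by measurable
  have dL: "cmod (L x) \<le> 3 * C / (1 + x\<^sup>2)" for x
    using decay_near[OF C0, of x "of_int \<lfloor>x + 1 / 2\<rfloor>"] abs_diff_floor_half[of x] d[of "of_int \<lfloor>x + 1 / 2\<rfloor>"]
    by (simp add: L_def)
  \<comment> \<open>Mean value estimate on the unit neighbourhood of \<open>x\<close>; the linear
    factor is what cancels the zero of the denominator in \<open>dG\<close>.\<close>
  have u: "cmod (f x - L x) \<le> 3 * C / (1 + x\<^sup>2) * \<bar>x - of_int \<lfloor>x + 1 / 2\<rfloor>\<bar>" for x
  proof -
    let ?n = "real_of_int \<lfloor>x + 1 / 2\<rfloor>"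
    have "norm (f x - f ?n) \<le> (3 * C / (1 + x\<^sup>2)) * norm (x - ?n)"
    proof (rule differentiable_bound[where S="{y. \<bar>x - y\<bar> \<le> 1}" and f'="\<lambda>y h. h *\<^sub>R f' y"])
      have "{y. \<bar>x - y\<bar> \<le> 1} = {x - 1..x + 1}" by (auto simp: abs_le_iff)
      then show "convex {y. \<bar>x - y\<bar> \<le> 1}" by simp
      show "(f has_derivative (\<lambda>h. h *\<^sub>R f' y)) (at y within {y. \<bar>x - y\<bar> \<le> 1})" for y
        using f[of y] by (simp add: has_vector_derivative_def has_derivative_at_withinI)
      show "onorm (\<lambda>h. h *\<^sub>R f' y) \<le> 3 * C / (1 + x\<^sup>2)" if "y \<in> {y. \<bar>x - y\<bar> \<le> 1}" for y
      proof (rule onorm_le)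
        have "cmod (f' y) \<le> 3 * C / (1 + x\<^sup>2)" using decay_near[OF C0, of x y] d'[of y] that by simp
        then show "norm (h *\<^sub>R f' y) \<le> 3 * C / (1 + x\<^sup>2) * norm h" for h
          by (simp add: mult.commute mult_left_mono del: times_divide_eq_left times_divide_eq_right)
      qed
    qed (use abs_diff_floor_half[of x] in auto)
    then show ?thesis by (simp add: L_def)
  qed
  have dG: "cmod (G x) \<le> 3 * C / (1 + x\<^sup>2)" for x
  proof (cases "x = of_int \<lfloor>x + 1 / 2\<rfloor>")
    case True
    then have "f x - L x = 0" by (simp add: L_def)
    then show ?thesis using C0 by (simp add: G_def)
  next
    case False
    let ?t = "\<bar>x - of_int \<lfloor>x + 1 / 2\<rfloor>\<bar>"
    have t: "0 < ?t" using False by simp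
    have "?t \<le> 4 * ?t" by simp
    also have "\<dots> \<le> cmod (cis (2 * pi * x) - 1)" by (rule cmod_cis_diff_1_ge[OF abs_diff_floor_half])
    finally have "?t \<le> cmod (cis (2 * pi * x) - 1)" .
    then have "cmod (G x) \<le> 3 * C / (1 + x\<^sup>2) * ?t / ?t"
      unfolding G_def norm_divide using u[of x] t C0 by (intro frac_le) auto
    then show ?thesis using t by simp
  qed
  have uG: "f x - L x = G x * (cis (2 * pi * x) - 1)" for x
  proof (cases "x = of_int \<lfloor>x + 1 / 2\<rfloor>")
    case True
    then have "f x - L x = 0" by (simp add: L_def)
    then show ?thesis by (simp add: G_def)
  next
    case False
    then have "cis (2 * pi * x) - 1 \<noteq> 0" using cmod_cis_diff_1_ge[OF abs_diff_floor_half[of x]] by auto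
    then show ?thesis by (simp add: G_def)
  qed
  \<comment> \<open>Only the integers, where the denominator vanishes, and the half-integers, where
    \<open>L\<close> may jump, are excluded.\<close>
  have cG: "AE x in lborel. isCont G x"
  proof -
    have cnt: "countable (\<int> \<union> (\<lambda>y. y - 1 / 2) ` \<int> :: real set)" by (auto simp: Ints_def)
    have "AE x in lborel. x \<notin> (\<int> \<union> (\<lambda>y. y - 1 / 2) ` \<int> :: real set)"
      by (rule AE_not_in[OF countable_imp_null_set_lborel[OF cnt]])
    then show ?thesis
    proof eventually_elim
      case (elim x)
      then have x: "x \<notin> \<int>" "x + 1 / 2 \<notin> \<int>" by (auto simp: image_iff)
      have "cis (2 * pi * x) \<noteq> 1"
        using x(1) cmod_cis_diff_1_ge[OF abs_diff_floor_half[of x]] by (metis Ints_of_int abs_le_zero_iff cancel_comm_monoid_add_class.diff_cancel eq_iff_diff_eq_0 mult_le_0_iff norm_zero not_numeral_le_zero)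
      moreover have "isCont L x"
      proof -
        have "((\<lambda>y. y + 1 / 2) \<longlongrightarrow> x + 1 / 2) (at x)" by (intro tendsto_intros)
        from eventually_floor_eq[OF this x(2)] have "\<forall>\<^sub>F y in at x. L y = L x"
          by eventually_elim (simp add: L_def)
        then show ?thesis unfolding isCont_def by (rule tendsto_eventually)
      qed
      moreover have "isCont (\<lambda>x. cis (2 * pi * x)) x"
        using has_vector_derivative_continuous[OF has_vector_derivative_cis] .
      ultimately show ?case
        unfolding G_def using c by (intro continuous_intros) auto
    qed
  qed
  \<comment> \<open>Under the integral, multiplication by \<open>cis (2 * pi * x)\<close> lowers the
    frequency \<open>k\<close> by one.\<close>
  have tel: "fourier f (of_int k) - fourier L (of_int k) = fourier G (of_int (k - 1)) - fourier G (of_int k)" for k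
  proof -
    let ?e = "\<lambda>k x. cis (- 2 * pi * of_int k * x)"
    have i: "integrable lborel (\<lambda>x. ?e k x * G x)" for k :: int by (rule integrable_cis_mult[OF mG dG])
    have "fourier f (of_int k) - fourier L (of_int k) = (LINT x|lborel. ?e k x * f x - ?e k x * L x)"
      unfolding fourier_cis
      by (rule Bochner_Integration.integral_diff[symmetric]) (rule integrable_cis_mult[OF m d] integrable_cis_mult[OF mL dL])+
    also have "\<dots> = (LINT x|lborel. ?e (k - 1) x * G x - ?e k x * G x)"
    proof (intro Bochner_Integration.integral_cong refl)
      fix x
      have e: "?e (k - 1) x = ?e k x * cis (2 * pi * x)" by (simp add: cis_mult algebra_simps)
      have "?e k x * f x - ?e k x * L x = ?e k x * (G x * (cis (2 * pi * x) - 1))"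
        by (simp only: right_diff_distrib[symmetric] uG)
      also have "\<dots> = ?e (k - 1) x * G x - ?e k x * G x"
        unfolding e by (simp only: right_diff_distrib mult_ac mult_1_right mult_1_left)
      finally show "?e k x * f x - ?e k x * L x = ?e (k - 1) x * G x - ?e k x * G x" .
    qed
    also have "\<dots> = fourier G (of_int (k - 1)) - fourier G (of_int k)"
      unfolding fourier_cis by (rule Bochner_Integration.integral_diff[OF i i])
    finally show ?thesis .
  qed
  \<comment> \<open>The ends are asymmetric: summing over \<open>-N..N\<close> leaves the
    frequencies \<open>-(N + 1)\<close> and \<open>N\<close>.\<close>
  have tel_sum: "(\<Sum>k=-int N..int N. fourier f (of_int k) - fourier L (of_int k)) =
      fourier G (- real (Suc N)) - fourier G (real N)" for N
  proof (induction N)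
    case 0
    then show ?case using tel[of 0] by simp
  next
    case (Suc N)
    let ?D = "\<lambda>k. fourier f (real_of_int k) - fourier L (real_of_int k)"
    have "{-int (Suc N)..int (Suc N)} = insert (- int (Suc N)) (insert (int (Suc N)) {-int N..int N})" by auto
    then have "(\<Sum>k=-int (Suc N)..int (Suc N). ?D k) = ?D (- int (Suc N)) + (?D (int (Suc N)) + (\<Sum>k=-int N..int N. ?D k))"
      by simp
    also have "?D (- int (Suc N)) = fourier G (- real (Suc (Suc N))) - fourier G (- real (Suc N))"
      unfolding tel by simp
    also have "?D (int (Suc N)) = fourier G (real N) - fourier G (real (Suc N))"
      unfolding tel by simp
    finally show ?case unfolding Suc by simp
  qed
  have "(\<lambda>N. fourier G (- real (Suc N))) \<longlonglongrightarrow> 0" "(\<lambda>N. fourier G (real N)) \<longlonglongrightarrow> 0"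
    by (rule riemann_lebesgue_decay[OF mG dG cG]; simp; real_asymp)+
  then have "(\<lambda>N. \<Sum>k=-int N..int N. fourier f (of_int k) - fourier L (of_int k)) \<longlonglongrightarrow> 0 - 0"
    unfolding tel_sum by (rule tendsto_diff)
  moreover have fL: "fourier L (of_int k) = (if k = 0 then (\<Sum>\<^sub>\<infinity>n::int. f (of_int n)) else 0)" for k
    unfolding L_def by (rule fourier_step_function[OF m d])
  have "(\<Sum>k=-int N..int N. fourier f (of_int k) - fourier L (of_int k)) =
      (\<Sum>k=-int N..int N. fourier f (of_int k)) - (\<Sum>\<^sub>\<infinity>n::int. f (of_int n))" for N
    by (simp add: sum_subtractf fL)
  ultimately have "(\<lambda>N. (\<Sum>k=-int N..int N. fourier f (of_int k)) - (\<Sum>\<^sub>\<infinity>n::int. f (of_int n))) \<longlonglongrightarrow> 0"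
    by simp
  then have "(\<lambda>N. \<Sum>k=-int N..int N. fourier f (of_int k)) \<longlonglongrightarrow> (\<Sum>\<^sub>\<infinity>n::int. f (of_int n))"
    by (rule LIM_zero_cancel)
  then show ?thesis
    using sum_symmetric_int_tendsto[OF sm] LIMSEQ_unique by blast
qed

section \<open>Poisson summation on shifted lattices and with periodic weights\<close>

lemma sum_has_sum_UN:
  fixes f :: "'b \<Rightarrow> complex"
  assumes "finite A" "\<And>a. a \<in> A \<Longrightarrow> (f has_sum s a) (B a)" "disjoint_family_on B A"
  shows "(f has_sum sum s A) (\<Union>a\<in>A. B a)"
  using assms by (intro sum_has_sum) (auto simp: disjoint_family_on_def)

lemma has_sum_finite_sum:
  fixes f :: "'a \<Rightarrow> 'b \<Rightarrow> complex"
  assumes "\<And>i. (f i has_sum s i) A"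
  shows "((\<lambda>x. \<Sum>i\<in>I. f i x) has_sum (\<Sum>i\<in>I. s i)) A"
  by (induction I rule: infinite_finite_induct) (use assms in \<open>auto intro: has_sum_add\<close>)

text \<open>Poisson summation applied to
  \<open>f x = cis (\<beta> * x) * \<phi> (x / T) / T\<close>: dilation by \<open>T\<close> sets the
  spacing and the modulation \<open>\<beta> = - 2 * pi * b / T\<close> moves the transform to the
  coset of \<open>b\<close>.\<close>

lemma poisson_summation_lattice:
  assumes \<phi>: "schwartz \<phi>" and T: "0 < T"
  shows "((\<lambda>j::int. fourier \<phi> (b + of_int j * T)) has_sum
      (\<Sum>\<^sub>\<infinity>k::int. cis (- 2 * pi * b * of_int k / T) * \<phi> (of_int k / T) / of_real T)) UNIV"
    and "(\<lambda>k::int. cis (- 2 * pi * b * of_int k / T) * \<phi> (of_int k / T) / of_real T) summable_on UNIV"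
proof -
  define \<beta> where "\<beta> = - 2 * pi * b / T"
  define \<phi>' where "\<phi>' = nderiv 1 \<phi>"
  define C where "C = (\<Sum>k\<le>1. schwartz_seminorm 0 k \<phi> + schwartz_seminorm 2 k \<phi>)"
  have n0: "nderiv 0 \<phi> = \<phi>" by (simp add: nderiv_def)
  have D: "cmod (nderiv k \<phi> x) \<le> C / (1 + x\<^sup>2)" if "k \<le> 1" for k x
  proof -
    have "schwartz_seminorm 0 k \<phi> + schwartz_seminorm 2 k \<phi> \<le> C"
      unfolding C_def using that schwartz_seminorm_nonneg[OF \<phi>] by (intro member_le_sum) (auto intro: add_nonneg_nonneg)
    then show ?thesis
      using schwartz_nderiv_decay[OF \<phi>, of k x] by (meson divide_right_mono order_trans zero_le_power2 add_nonneg_nonneg zero_le_one)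
  qed
  have C0: "0 \<le> C" using order_trans[OF norm_ge_zero D, of 0 0] by simp
  have D0: "cmod (\<phi> x) \<le> C / (1 + x\<^sup>2)" and D1: "cmod (\<phi>' x) \<le> C / (1 + x\<^sup>2)" for x
    using D[of 0 x] D[of 1 x] by (simp_all add: n0 \<phi>'_def)
  have vd: "(\<phi> has_vector_derivative \<phi>' x) (at x)" for x
  proof -
    have "\<phi> differentiable (at x)" using \<phi> n0 by (metis schwartz_def)
    then show ?thesis by (simp add: \<phi>'_def nderiv_def vector_derivative_works[symmetric])
  qed
  define K where "K = 1 + T\<^sup>2"
  have scale: "C / (1 + (x / T)\<^sup>2) \<le> K * C / (1 + x\<^sup>2)" for x
  proof -
    have "1 + x\<^sup>2 \<le> K * (1 + (x / T)\<^sup>2)"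
      using T by (simp add: K_def power_divide algebra_simps add_divide_distrib)
    from mult_left_mono[OF this C0] show ?thesis
      by (simp add: divide_le_eq le_divide_eq add_pos_nonneg mult_ac)
  qed
  define f where "f x = (cis (\<beta> * x) * \<phi> (x / T)) / of_real T" for x
  define f' where "f' x = (\<i> * of_real \<beta> * cis (\<beta> * x) * \<phi> (x / T) + cis (\<beta> * x) * (\<phi>' (x / T) / of_real T)) / of_real T" for x
  have f: "(f has_vector_derivative f' x) (at x)" for x
  proof -
    have "((\<lambda>x. x / T) has_vector_derivative 1 / T) (at x)"
      using T by (auto intro!: derivative_eq_intros simp: has_real_derivative_iff_has_vector_derivative[symmetric])
    from vector_diff_chain_at[OF this vd]
    have "((\<lambda>x. \<phi> (x / T)) has_vector_derivative \<phi>' (x / T) / of_real T) (at x)"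
      by (simp add: comp_def scaleR_conv_of_real divide_inverse mult.commute)
    from has_vector_derivative_divide[OF has_vector_derivative_mult[OF has_vector_derivative_cis this], of \<beta> "of_real T"]
    show ?thesis by (simp add: f_def[abs_def] f'_def add.commute)
  qed
  \<comment> \<open>The summands are arranged so that one constant bounds both \<open>f\<close> and
    \<open>f'\<close>.\<close>
  define Q where "Q = (1 + \<bar>\<beta>\<bar> + 1 / T) / T * (K * C)"
  have X: "0 \<le> K * C / (1 + x\<^sup>2)" for x using C0 by (simp add: K_def)
  have d: "cmod (f x) \<le> Q / (1 + x\<^sup>2)" for x
  proof -
    have "cmod (f x) = cmod (\<phi> (x / T)) / T"
      using T by (simp add: f_def norm_mult norm_divide)
    also have "\<dots> \<le> (K * C / (1 + x\<^sup>2)) / T"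
      by (intro divide_right_mono order_trans[OF D0 scale]) (use T in auto)
    also have "\<dots> = 1 / T * (K * C / (1 + x\<^sup>2))" by simp
    also have "\<dots> \<le> (1 + \<bar>\<beta>\<bar> + 1 / T) / T * (K * C / (1 + x\<^sup>2))"
      using T by (intro mult_right_mono X divide_right_mono) auto
    finally show ?thesis by (simp add: Q_def)
  qed
  have d': "cmod (f' x) \<le> Q / (1 + x\<^sup>2)" for x
  proof -
    let ?X = "K * C / (1 + x\<^sup>2)"
    have "cmod (f' x) \<le> (\<bar>\<beta>\<bar> * cmod (\<phi> (x / T)) + cmod (\<phi>' (x / T)) / T) / T"
      unfolding f'_def norm_divide using T
      by (auto intro!: divide_right_mono order_trans[OF norm_triangle_ineq] simp: norm_mult norm_divide)
    also have "\<dots> \<le> (\<bar>\<beta>\<bar> * ?X + ?X / T) / T"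
      using order_trans[OF D0 scale, of x] order_trans[OF D1 scale, of x] T
      by (intro divide_right_mono add_mono mult_left_mono) auto
    also have "\<dots> = (\<bar>\<beta>\<bar> + 1 / T) / T * ?X"
      by (simp add: algebra_simps add_divide_distrib)
    also have "\<dots> \<le> (1 + \<bar>\<beta>\<bar> + 1 / T) / T * ?X"
      using T by (intro mult_right_mono X divide_right_mono) auto
    finally show ?thesis by (simp add: Q_def)
  qed
  have ff: "fourier f (of_int j) = fourier \<phi> (b + of_int j * T)" for j :: int
  proof -
    have "fourier f (of_int j) = \<bar>T\<bar> *\<^sub>R (LINT x|lborel. cis (- 2 * pi * of_int j * (0 + T * x)) * f (0 + T * x))"
      unfolding fourier_cis by (rule lborel_integral_real_affine) (use T in auto)
    also have "\<dots> = (LINT x|lborel. of_real T * (cis (- 2 * pi * of_int j * (0 + T * x)) * f (0 + T * x)))"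
      using T by (simp add: scaleR_conv_of_real)
    also have "\<dots> = fourier \<phi> (b + of_int j * T)"
      unfolding fourier_cis
    proof (intro Bochner_Integration.integral_cong refl)
      fix x
      have "cis (- 2 * pi * of_int j * (0 + T * x)) * cis (\<beta> * (0 + T * x)) = cis (- 2 * pi * (b + of_int j * T) * x)"
        using T by (simp add: cis_mult \<beta>_def algebra_simps)
      then show "of_real T * (cis (- 2 * pi * of_int j * (0 + T * x)) * f (0 + T * x)) =
          cis (- 2 * pi * (b + of_int j * T) * x) * \<phi> x"
        using T by (simp add: f_def mult.assoc[symmetric])
    qed
    finally show ?thesis .
  qed
  obtain C' where C': "cmod (fourier \<phi> \<xi>) \<le> C' / (1 + \<xi>\<^sup>2)" for \<xi>
    using fourier_schwartz_decay[OF \<phi>] by blast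
  have C'0: "0 \<le> C'" using order_trans[OF norm_ge_zero C', of 0] by simp
  have "cmod (fourier \<phi> (b + x * T)) \<le> ((1 + 2 * (1 + b\<^sup>2) / T\<^sup>2) * C') / (1 + x\<^sup>2)" for x
  proof -
    let ?y = "b + x * T"
    have "(x * T)\<^sup>2 \<le> 2 * (1 + b\<^sup>2) * (1 + ?y\<^sup>2)"
    proof -
      \<comment> \<open>This sum of squares is exactly the difference of the two sides of the
        claim.\<close>
      have "0 \<le> (?y + b)\<^sup>2 + 2 + 2 * (b * ?y)\<^sup>2" by simp
      then show ?thesis by (simp add: power2_eq_square algebra_simps)
    qed
    then have "x\<^sup>2 \<le> 2 * (1 + b\<^sup>2) / T\<^sup>2 * (1 + ?y\<^sup>2)"
      using T by (simp add: power_mult_distrib field_simps)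
    then have "1 + x\<^sup>2 \<le> (1 + 2 * (1 + b\<^sup>2) / T\<^sup>2) * (1 + ?y\<^sup>2)"
      unfolding distrib_right by (smt (verit) zero_le_power2)
    from mult_left_mono[OF this C'0]
    have "C' / (1 + ?y\<^sup>2) \<le> ((1 + 2 * (1 + b\<^sup>2) / T\<^sup>2) * C') / (1 + x\<^sup>2)"
      by (simp add: divide_le_eq le_divide_eq add_pos_nonneg mult_ac)
    then show ?thesis using C' order_trans by blast
  qed
  from summable_on_decay_int[OF this]
  have sm: "(\<lambda>j::int. fourier f (of_int j)) summable_on UNIV" by (simp add: ff)
  have "(\<Sum>\<^sub>\<infinity>n::int. f (of_int n)) = (\<Sum>\<^sub>\<infinity>k::int. fourier f (of_int k))"
    by (rule poisson_summation[OF f d d' sm])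
  then have "((\<lambda>j::int. fourier f (of_int j)) has_sum (\<Sum>\<^sub>\<infinity>n::int. f (of_int n))) UNIV"
    using has_sum_infsum[OF sm] by simp
  moreover have fe: "f (of_int k) = cis (- 2 * pi * b * of_int k / T) * \<phi> (of_int k / T) / of_real T" for k :: int
    by (simp add: f_def \<beta>_def)
  ultimately show "((\<lambda>j::int. fourier \<phi> (b + of_int j * T)) has_sum
      (\<Sum>\<^sub>\<infinity>k::int. cis (- 2 * pi * b * of_int k / T) * \<phi> (of_int k / T) / of_real T)) UNIV"
    by (simp only: ff fe)
  show "(\<lambda>k::int. cis (- 2 * pi * b * of_int k / T) * \<phi> (of_int k / T) / of_real T) summable_on UNIV"
    using summable_on_decay_int[OF d] by (simp only: fe)
qed

text \<open>Unnormalised forward transform; the factor \<open>1 / (N * h)\<close> is carried by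
  Poisson summation. Integer frequencies of either sign are allowed, so that it is itself a periodic
  weight on the dual lattice.\<close>

definition dft :: "nat \<Rightarrow> (int \<Rightarrow> complex) \<Rightarrow> int \<Rightarrow> complex" where
  "dft N f k = (\<Sum>r<N. f (int r) * cis (- 2 * pi * real r * of_int k / real N))"

lemma periodic_int_mult:
  fixes f :: "int \<Rightarrow> 'a"
  assumes "\<And>j. f (j + N) = f j"
  shows "f (r + q * N) = f r"
proof (induction q rule: int_induct[where k=0])
  case base
  show ?case by simp
next
  case (step1 i)
  have "r + (i + 1) * N = (r + i * N) + N" by (simp add: algebra_simps)
  then show ?case using assms step1 by metis
next
  case (step2 i)
  have "r + i * N = (r + (i - 1) * N) + N" by (simp add: algebra_simps)
  then show ?case using assms step2 by metis
qed

text \<open>Modulo \<open>N\<close> the lattice splits into \<open>N\<close> cosets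
  \<open>h * r + T * \<int>\<close> with \<open>T = N * h\<close>, on each of which the weight is
  constant. The phases of the cosets add up to the discrete Fourier transform.\<close>

lemma poisson_summation_periodic:
  assumes \<phi>: "schwartz \<phi>" and h: "0 < h" and N: "0 < N" and per: "\<And>j. f (j + int N) = f j"
  shows "(\<Sum>\<^sub>\<infinity>j::int. f j * fourier \<phi> (h * of_int j)) =
    (\<Sum>\<^sub>\<infinity>k::int. dft N f k / of_real (N * h) * \<phi> (of_int k / (N * h)))"
proof -
  define T where "T = N * h"
  have T: "0 < T" using h N by (simp add: T_def)
  define B where "B r = range (\<lambda>q::int. int r + q * int N)" for r
  define s where "s r = (\<Sum>\<^sub>\<infinity>k::int. cis (- 2 * pi * (h * r) * of_int k / T) * \<phi> (of_int k / T) / of_real T)" for r :: nat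
  note P = poisson_summation_lattice[OF \<phi> T]
  have "((\<lambda>j. f j * fourier \<phi> (h * of_int j)) has_sum f (int r) * s r) (B r)" for r
  proof -
    have "((\<lambda>q::int. f (int r) * fourier \<phi> (h * r + of_int q * T)) has_sum f (int r) * s r) UNIV"
      unfolding s_def by (intro has_sum_cmult_right P(1))
    moreover have "f (int r) * fourier \<phi> (h * r + of_int q * T) =
        f (int r + q * int N) * fourier \<phi> (h * of_int (int r + q * int N))" for q :: int
      by (simp add: periodic_int_mult[of f, OF per] T_def algebra_simps)
    ultimately show ?thesis
      unfolding B_def using N by (subst has_sum_reindex) (auto simp: inj_on_def comp_def)
  qed
  moreover have "disjoint_family_on B {..<N}"
  proof -
    have "j mod int N = int r" if "j \<in> B r" "r < N" for j r
      using that by (auto simp: B_def)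
    then show ?thesis unfolding disjoint_family_on_def
      by (metis (no_types, lifting) disjoint_iff lessThan_iff of_nat_eq_iff)
  qed
  ultimately have "((\<lambda>j. f j * fourier \<phi> (h * of_int j)) has_sum (\<Sum>r<N. f (int r) * s r)) (\<Union>r<N. B r)"
    by (intro sum_has_sum_UN) auto
  moreover have "(\<Union>r<N. B r) = UNIV"
  proof (intro set_eqI iffI UNIV_I)
    fix j :: int
    have "j = int (nat (j mod int N)) + (j div int N) * int N" using N by simp
    moreover have "nat (j mod int N) < N" using N by (simp add: nat_less_iff)
    ultimately show "j \<in> (\<Union>r<N. B r)" unfolding B_def by blast
  qed
  ultimately have "(\<Sum>\<^sub>\<infinity>j::int. f j * fourier \<phi> (h * of_int j)) = (\<Sum>r<N. f (int r) * s r)"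
    by (simp add: infsumI)
  also have "\<dots> = (\<Sum>\<^sub>\<infinity>k::int. \<Sum>r<N. f (int r) * (cis (- 2 * pi * (h * r) * of_int k / T) * \<phi> (of_int k / T) / of_real T))"
  proof (rule infsumI[symmetric], rule has_sum_finite_sum)
    show "((\<lambda>k::int. f (int r) * (cis (- 2 * pi * (h * r) * of_int k / T) * \<phi> (of_int k / T) / of_real T))
        has_sum f (int r) * s r) UNIV" for r
      unfolding s_def by (intro has_sum_cmult_right has_sum_infsum P(2))
  qed
  also have "\<dots> = (\<Sum>\<^sub>\<infinity>k::int. dft N f k / of_real T * \<phi> (of_int k / T))"
  proof (rule infsum_cong)
    fix k :: int
    have e: "- 2 * pi * (h * r) * of_int k / T = - 2 * pi * real r * of_int k / real N" for r :: nat
      using h by (simp add: T_def)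
    show "(\<Sum>r<N. f (int r) * (cis (- 2 * pi * (h * r) * of_int k / T) * \<phi> (of_int k / T) / of_real T)) =
        dft N f k / of_real T * \<phi> (of_int k / T)"
      unfolding e dft_def sum_divide_distrib sum_distrib_right by (intro sum.cong) simp_all
  qed
  finally show ?thesis by (simp add: T_def)
qed

section \<open>Sums of incommensurable combs\<close>

text \<open>Common frame for \<open>\<nu>\<close> and its transform. The origin lies on every
  lattice, hence \<open>weight_0\<close>. A unit window holds at most \<open>1 / h n + 1\<close>
  points of comb \<open>n\<close>, so \<open>A_summable\<close> caps the mass there at
  \<open>(1 / 2) ^ n\<close>. \<open>escape\<close> keeps the atoms at distance at least
  \<open>n / 4\<close> from 0; the 4 is dictated by the dual side, where the period is
  \<open>4 * M\<close>.\<close>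

locale incommensurable_combs =
  fixes h :: "nat \<Rightarrow> real" and a :: "nat \<Rightarrow> int \<Rightarrow> complex" and A :: "nat \<Rightarrow> real"
  assumes spacing_pos: "0 < h n"
    and incommensurable: "n \<noteq> m \<Longrightarrow> i \<noteq> 0 \<Longrightarrow> h n * of_int i \<noteq> h m * of_int j"
    and weight_le: "cmod (a n j) \<le> A n"
    and A_summable: "A n * (1 / h n + 1) \<le> (1 / 2) ^ n"
    and weight_0: "a n 0 = 0"
    and escape: "a n j \<noteq> 0 \<Longrightarrow> real n \<le> 4 * (h n * \<bar>of_int j\<bar>)"
    and infinitely_many: "infinite {j. a n j \<noteq> 0}"
begin

definition index :: "(nat \<times> int) set" where "index = {(n, j). a n j \<noteq> 0}"

definition pos :: "nat \<times> int \<Rightarrow> real" where "pos = (\<lambda>(n, j). h n * of_int j)"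

definition supp :: "real set" where "supp = pos ` index"

text \<open>The inverse is meaningful because each atom comes from exactly one pair, by
  \<open>inj_pos\<close>.\<close>

definition weight :: "real \<Rightarrow> complex" where "weight l = (\<lambda>(n, j). a n j) (inv_into index pos l)"

text \<open>Different lattices meet only at 0, and \<open>weight_0\<close> excludes that
  point.\<close>

lemma inj_pos: "inj_on pos index"
proof (rule inj_onI, clarify)
  fix n j m i
  assume *: "(n, j) \<in> index" "(m, i) \<in> index" "pos (n, j) = pos (m, i)"
  then have "j \<noteq> 0" using weight_0 by (auto simp: index_def)
  then have "n = m" using incommensurable[of n m j i] * by (auto simp: pos_def)
  then show "n = m \<and> j = i" using * spacing_pos[of m] by (simp add: pos_def)
qed

lemma weight_pos: "(n, j) \<in> index \<Longrightarrow> weight (pos (n, j)) = a n j"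
  unfolding weight_def by (simp add: inv_into_f_f[OF inj_pos])

lemma weight_nonzero: "l \<in> supp \<Longrightarrow> weight l \<noteq> 0"
  by (auto simp: supp_def weight_pos) (auto simp: index_def)

text \<open>\<open>escape\<close> leaves finitely many combs that reach a given interval, and each
  lattice has finitely many points in it.\<close>

lemma discrete_supp: "discrete_subset supp"
  unfolding discrete_subset_def
proof (intro allI)
  fix u v :: real
  define R where "R = \<bar>u\<bar> + \<bar>v\<bar>"
  let ?J = "\<lambda>n. {- \<lfloor>R / h n\<rfloor>..\<lfloor>R / h n\<rfloor>}"
  have "supp \<inter> {u..v} \<subseteq> pos ` (SIGMA n:{..nat \<lfloor>4 * R\<rfloor>}. ?J n)"
  proof
    fix l assume l: "l \<in> supp \<inter> {u..v}"
    then obtain n j where nj: "(n, j) \<in> index" "l = h n * of_int j" by (auto simp: supp_def pos_def)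
    have "\<bar>l\<bar> \<le> R" using l by (auto simp: R_def)
    then have jR: "h n * \<bar>of_int j\<bar> \<le> R" using spacing_pos[of n] nj(2) by (simp add: abs_mult)
    then have "\<bar>real_of_int j\<bar> \<le> R / h n" using spacing_pos[of n] by (simp add: field_simps)
    then have "\<bar>j\<bar> \<le> \<lfloor>R / h n\<rfloor>" by (simp add: le_floor_iff)
    moreover have "real n \<le> 4 * R" using escape[of n j] nj(1) jR by (auto simp: index_def)
    then have "n \<le> nat \<lfloor>4 * R\<rfloor>" by (simp add: le_nat_floor)
    ultimately show "l \<in> pos ` (SIGMA n:{..nat \<lfloor>4 * R\<rfloor>}. ?J n)"
      using nj(2) by (intro image_eqI[of _ _ "(n, j)"]) (auto simp: pos_def abs_le_iff)
  qed
  then show "finite (supp \<inter> {u..v})" by (rule finite_subset) auto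
qed

lemma card_window:
  "finite {j::int. h n * of_int j \<in> {x..x + 1}}"
  "real (card {j::int. h n * of_int j \<in> {x..x + 1}}) \<le> 1 / h n + 1"
proof -
  let ?I = "{\<lceil>x / h n\<rceil>..\<lfloor>(x + 1) / h n\<rfloor>}"
  have J: "{j::int. h n * of_int j \<in> {x..x + 1}} = ?I"
    using spacing_pos[of n] by (auto simp: ceiling_le_iff le_floor_iff field_simps)
  show "finite {j::int. h n * of_int j \<in> {x..x + 1}}" unfolding J by simp
  have "real_of_int \<lfloor>(x + 1) / h n\<rfloor> - real_of_int \<lceil>x / h n\<rceil> \<le> (x + 1) / h n - x / h n"
    by (intro diff_mono) auto
  also have "\<dots> = 1 / h n" by (simp add: add_divide_distrib)
  finally have "real_of_int \<lfloor>(x + 1) / h n\<rfloor> - real_of_int \<lceil>x / h n\<rceil> \<le> 1 / h n" .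
  moreover have "0 \<le> 1 / h n" using spacing_pos[of n] by simp
  ultimately have "real (nat (\<lfloor>(x + 1) / h n\<rfloor> + 1 - \<lceil>x / h n\<rceil>)) \<le> 1 / h n + 1"
    by (cases "\<lfloor>(x + 1) / h n\<rfloor> + 1 \<ge> \<lceil>x / h n\<rceil>") (simp_all add: of_nat_nat)
  then show "real (card {j::int. h n * of_int j \<in> {x..x + 1}}) \<le> 1 / h n + 1" unfolding J by simp
qed

text \<open>The masses of the separate combs in a window are bounded by a geometric series, whose
  total is 2.\<close>

lemma window_bound: "(\<Sum>l\<in>supp \<inter> {x..x + 1}. cmod (weight l)) \<le> 2"
proof -
  let ?J = "\<lambda>n. {j::int. h n * of_int j \<in> {x..x + 1}}"
  define P where "P = {p \<in> index. pos p \<in> {x..x + 1}}"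
  have img: "supp \<inter> {x..x + 1} = pos ` P" by (auto simp: supp_def P_def)
  have inj: "inj_on pos P" by (rule inj_on_subset[OF inj_pos]) (auto simp: P_def)
  have "finite (supp \<inter> {x..x + 1})" using discrete_supp by (simp add: discrete_subset_def)
  then have fin: "finite P" unfolding img using inj by (rule finite_imageD)
  \<comment> \<open>By discreteness only finitely many combs meet the window, so all sums below are
    finite.\<close>
  obtain K where K: "fst ` P \<subseteq> {..<K}"
    using finite_nat_bounded[of "fst ` P"] fin by auto
  have sub: "P \<subseteq> (SIGMA n:{..<K}. ?J n)" using K by (force simp: P_def pos_def)
  have "(\<Sum>l\<in>supp \<inter> {x..x + 1}. cmod (weight l)) = (\<Sum>p\<in>P. cmod (weight (pos p)))"
    unfolding img using inj by (rule sum.reindex_cong) auto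
  also have "\<dots> = (\<Sum>(n, j)\<in>P. cmod (a n j))"
    by (intro sum.cong) (auto simp: P_def weight_pos)
  also have "\<dots> \<le> (\<Sum>(n, j)\<in>(SIGMA n:{..<K}. ?J n). cmod (a n j))"
    using sub card_window(1) by (intro sum_mono2) auto
  also have "\<dots> = (\<Sum>n<K. \<Sum>j\<in>?J n. cmod (a n j))"
    using card_window(1) by (intro sum.Sigma[symmetric]) auto
  also have "\<dots> \<le> (\<Sum>n<K. (1 / 2) ^ n)"
  proof (rule sum_mono)
    fix n
    have A0: "0 \<le> A n" using weight_le[of n 0] norm_ge_zero order_trans by blast
    have "(\<Sum>j\<in>?J n. cmod (a n j)) \<le> real (card (?J n)) * A n"
      using weight_le by (rule sum_bounded_above)
    also have "\<dots> \<le> (1 / h n + 1) * A n"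
      using card_window(2) A0 by (rule mult_right_mono)
    also have "\<dots> \<le> (1 / 2) ^ n" using A_summable[of n] by (simp add: mult.commute)
    finally show "(\<Sum>j\<in>?J n. cmod (a n j)) \<le> (1 / 2) ^ n" .
  qed
  also have "\<dots> \<le> 2" by (simp add: geometric_sum)
  finally show ?thesis .
qed

lemma translation_bounded: "translation_bounded_measure (point_sum supp weight)"
  using translation_bounded_point_sum[OF discrete_supp window_bound] .

lemmas weight_summable = summable_on_window_bound[OF discrete_supp window_bound]

lemma tempered: "tempered_measure (point_sum supp weight)"
  by (rule tempered_measure_point_sum[OF discrete_supp weight_summable])

text \<open>Absolute summability over the pairs \<open>(n, j)\<close> permits grouping by comb, so
  that Poisson summation can be applied to one comb at a time. Pairs outside \<open>index\<close>
  contribute 0.\<close>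

lemma cm_integral_decay:
  assumes "f \<in> borel_measurable borel" "\<And>x. cmod (f x) \<le> C / (1 + x\<^sup>2)"
  shows "cm_integral (point_sum supp weight) f = (\<Sum>\<^sub>\<infinity>n. \<Sum>\<^sub>\<infinity>j. a n j * f (h n * of_int j))"
proof -
  let ?F = "\<lambda>(n, j). a n j * f (h n * of_int j)"
  have F: "weight (pos p) * f (pos p) = ?F p" if "p \<in> index" for p
    using that by (cases p) (simp add: weight_pos, simp add: pos_def)
  have "(\<lambda>l. weight l * f l) summable_on pos ` index"
    using summable_on_mult_decay(1)[OF weight_summable assms(2)] by (simp add: supp_def)
  then have "(\<lambda>p. weight (pos p) * f (pos p)) summable_on index"
    by (simp add: summable_on_reindex[OF inj_pos] comp_def)
  then have "?F summable_on index"
    using summable_on_cong[of index, OF F] by simp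
  then have s: "?F summable_on UNIV \<times> UNIV"
    by (rule summable_on_cong_neutral[THEN iffD1, rotated -1]) (auto simp: index_def)
  have "cm_integral (point_sum supp weight) f = (\<Sum>\<^sub>\<infinity>l\<in>supp. weight l * f l)"
    by (rule cm_integral_point_sum_decay[OF discrete_supp weight_summable assms])
  also have "\<dots> = (\<Sum>\<^sub>\<infinity>p\<in>index. weight (pos p) * f (pos p))"
    by (simp add: supp_def infsum_reindex[OF inj_pos] comp_def)
  also have "\<dots> = (\<Sum>\<^sub>\<infinity>p\<in>UNIV \<times> UNIV. ?F p)"
    by (rule infsum_cong_neutral) (use F in \<open>auto simp: index_def\<close>)
  also have "\<dots> = (\<Sum>\<^sub>\<infinity>n. \<Sum>\<^sub>\<infinity>j. a n j * f (h n * of_int j))"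
    using infsum_Sigma'_banach[of "\<lambda>n j. a n j * f (h n * of_int j)" UNIV "\<lambda>_. UNIV"] s by simp
  finally show ?thesis .
qed

text \<open>Two common points make the difference \<open>b\<close> of the progression a rational
  multiple of the spacing; doing this for two combs and eliminating \<open>b\<close> contradicts
  \<open>incommensurable\<close>.\<close>

lemma arithmetic_progression_meets_one_comb:
  assumes P: "arithmetic_progression P"
    and n: "infinite (P \<inter> range (\<lambda>j. h n * of_int j))" and m: "infinite (P \<inter> range (\<lambda>j. h m * of_int j))"
  shows "n = m"
proof (rule ccontr)
  assume "n \<noteq> m"
  obtain u b where b: "b > 0" "P = {u + b * of_int k | k :: int. True}"
    using P by (auto simp: arithmetic_progression_def)
  have gap: "\<exists>i k :: int. i \<noteq> 0 \<and> k \<noteq> 0 \<and> b * of_int i = h n * of_int k"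
    if inf: "infinite (P \<inter> range (\<lambda>j. h n * of_int j))" for n
  proof -
    obtain x where x: "x \<in> P \<inter> range (\<lambda>j. h n * of_int j)" using inf by (metis ex_in_conv finite.emptyI)
    obtain y where y: "y \<in> P \<inter> range (\<lambda>j. h n * of_int j)" "y \<noteq> x"
      using inf by (metis finite.emptyI finite_insert finite_subset insertCI subsetI)
    obtain p q i j :: int where "x = u + b * of_int p" "y = u + b * of_int q" "x = h n * of_int i" "y = h n * of_int j"
      using x y b(2) by auto
    then have "b * of_int (p - q) = h n * of_int (i - j)" "p - q \<noteq> 0"
      using y(2) by (auto simp: algebra_simps)
    moreover from this have "i - j \<noteq> 0" using b(1) by (metis mult_eq_0_iff of_int_eq_0_iff of_int_0 less_irrefl)
    ultimately show ?thesis by blast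
  qed
  obtain i k where i: "i \<noteq> 0" "k \<noteq> 0" "b * of_int i = h n * of_int k" using gap[OF n] by blast
  obtain j l where j: "j \<noteq> 0" "l \<noteq> 0" "b * of_int j = h m * of_int l" using gap[OF m] by blast
  have "h n * of_int (k * j) = b * of_int i * of_int j" using i(3) by simp
  also have "\<dots> = h m * of_int (l * i)" using j(3) by (simp add: mult_ac)
  finally have "h n * of_int (k * j) = h m * of_int (l * i)" .
  moreover have "k * j \<noteq> 0" using i j by simp
  ultimately show False using incommensurable[OF \<open>n \<noteq> m\<close>] by blast
qed

text \<open>By pigeonhole every comb has infinitely many atoms on some progression
  \<open>Q n\<close>. No progression serves two combs, so \<open>Q\<close> would inject the naturals
  into a finite set.\<close>

lemma not_in_finite_union_of_APs: "\<not> in_finite_union_of_APs supp"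
proof
  assume "in_finite_union_of_APs supp"
  then obtain \<P> where \<P>: "finite \<P>" "\<And>P. P \<in> \<P> \<Longrightarrow> arithmetic_progression P" "supp \<subseteq> \<Union>\<P>"
    unfolding in_finite_union_of_APs_def by blast
  have "\<exists>P\<in>\<P>. infinite (P \<inter> range (\<lambda>j. h n * of_int j))" for n
  proof (rule ccontr)
    assume "\<not> ?thesis"
    then have "finite (\<Union>P\<in>\<P>. P \<inter> range (\<lambda>j. h n * of_int j))" using \<P>(1) by blast
    moreover have "(\<lambda>j. h n * of_int j) ` {j. a n j \<noteq> 0} \<subseteq> (\<Union>P\<in>\<P>. P \<inter> range (\<lambda>j. h n * of_int j))"
    proof safe
      fix j assume "a n j \<noteq> 0"
      then have "h n * of_int j \<in> supp" by (auto simp: supp_def index_def pos_def)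
      then show "h n * of_int j \<in> (\<Union>P\<in>\<P>. P \<inter> range (\<lambda>j. h n * of_int j))" using \<P>(3) by blast
    qed
    moreover have "inj_on (\<lambda>j. h n * of_int j) {j. a n j \<noteq> 0}"
      using spacing_pos[of n] by (auto simp: inj_on_def)
    ultimately show False using infinitely_many[of n] finite_imageD finite_subset by blast
  qed
  then obtain Q where Q: "\<And>n. Q n \<in> \<P>" "\<And>n. infinite (Q n \<inter> range (\<lambda>j. h n * of_int j))" by metis
  have "inj Q"
    by (rule injI) (metis Q \<P>(2) arithmetic_progression_meets_one_comb)
  moreover have "finite (range Q)" using \<P>(1) Q(1) by (meson finite_subset image_subsetI)
  ultimately show False using finite_imageD infinite_UNIV_nat by blast
qed

lemma not_finitely_poisson_derived: "\<not> finitely_poisson_derived (point_sum supp weight)"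
  using finitely_poisson_derived_point_sum weight_nonzero not_in_finite_union_of_APs by blast

end

section \<open>Periodic weights with a double spectral gap\<close>

lemma dft_periodic:
  assumes "0 < N"
  shows "dft N f (k + int N) = dft N f k"
  unfolding dft_def
proof (intro sum.cong refl)
  fix r
  have "- 2 * pi * real r * of_int (k + int N) / real N = - 2 * pi * real r * of_int k / real N + 2 * pi * of_int (- int r)"
    using assms by (simp add: field_simps)
  then have "cis (- 2 * pi * real r * of_int (k + int N) / real N) = cis (- 2 * pi * real r * of_int k / real N)"
    by (simp only: cis_mult[symmetric] cis_multiple_2pi Ints_of_int mult_1_right)
  then show "f (int r) * cis (- 2 * pi * real r * of_int (k + int N) / real N) =
      f (int r) * cis (- 2 * pi * real r * of_int k / real N)" by simp
qed

lemma cmod_dft_le: "cmod (dft N f k) \<le> (\<Sum>r<N. cmod (f (int r)))"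
  unfolding dft_def by (rule order_trans[OF norm_sum]) (simp add: norm_mult)

text \<open>Deliberately crude: the same sum over one period also bounds the transform, by
  \<open>cmod_dft_le\<close>, so one constant controls both sides.\<close>

lemma cmod_periodic_le:
  assumes N: "0 < N" and per: "\<And>j. f (j + int N) = f j"
  shows "cmod (f j) \<le> (\<Sum>r<N. cmod (f (int r)))"
proof -
  have "f (j mod int N + (j div int N) * int N) = f (j mod int N)"
    by (rule periodic_int_mult) (rule per)
  then have "f j = f (int (nat (j mod int N)))" using N by simp
  moreover have "nat (j mod int N) \<in> {..<N}" using N by (simp add: nat_less_iff)
  ultimately show ?thesis by (metis (no_types, lifting) finite_lessThan member_le_sum norm_ge_zero)
qed

lemma infinite_periodic_nonzero:
  fixes f :: "int \<Rightarrow> complex"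
  assumes "0 < N" "\<And>j. f (j + int N) = f j" "f j0 \<noteq> 0"
  shows "infinite {j. f j \<noteq> 0}"
proof -
  have "range (\<lambda>q. j0 + q * int N) \<subseteq> {j. f j \<noteq> 0}"
    using periodic_int_mult[of f "int N", OF assms(2)] assms(3) by auto
  moreover have "infinite (range (\<lambda>q. j0 + q * int N))"
    using assms(1) by (auto simp: inj_def dest!: finite_imageD)
  ultimately show ?thesis using finite_subset by blast
qed

text \<open>The coefficients of a polynomial of degree \<open>2M - 1\<close> whose roots are the \<open>4M\<close>-th roots of unity
  of index less than \<open>M\<close> in absolute value, placed in the middle of the period.\<close>

lemma periodic_double_gap:
  assumes M: "0 < M"
  obtains f :: "int \<Rightarrow> complex" where "\<And>j. f (j + int (4 * M)) = f j"
    and "\<And>j. \<bar>j\<bar> < int M \<Longrightarrow> f j = 0" and "\<And>k. \<bar>k\<bar> < int M \<Longrightarrow> dft (4 * M) f k = 0"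
    and "\<exists>j. f j \<noteq> 0" and "\<exists>k. dft (4 * M) f k \<noteq> 0"
proof -
  define w where "w k = cis (2 * pi * of_int k / real (4 * M))" for k :: int
  let ?K = "{- (int M - 1)..int M - 1}"
  define p where "p = (\<Prod>k\<in>?K. [:- w k, 1:])"
  \<comment> \<open>The residues \<open>M..3 * M - 1\<close> carry the \<open>2 * M\<close>
    coefficients. Larger residues, which represent the negative \<open>j\<close> of the gap, read
    \<open>coeff p\<close> above the degree and give 0.\<close>
  define f where "f j = (let r = j mod int (4 * M) in if int M \<le> r then coeff p (nat (r - int M)) else 0)" for j
  have lead: "lead_coeff p = 1" unfolding p_def by (simp add: lead_coeff_prod)
  have "degree p = card ?K"
    unfolding p_def by (subst degree_prod_sum_eq) auto
  then have deg: "degree p = 2 * M - 1" by simp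
  have per: "f (j + int (4 * M)) = f j" for j by (simp add: f_def)
  have gap: "f j = 0" if "\<bar>j\<bar> < int M" for j
  proof (cases "0 \<le> j")
    case True
    then have "j mod int (4 * M) = j" using that by simp
    then show ?thesis using that by (simp add: f_def)
  next
    case False
    have "(j + int (4 * M)) mod int (4 * M) = j + int (4 * M)" using that False by (intro mod_pos_pos_trivial) auto
    then have "f j = (if int M \<le> j + int (4 * M) then coeff p (nat (j + int (4 * M) - int M)) else 0)"
      unfolding per[of j, symmetric] by (simp only: f_def Let_def)
    moreover have "degree p < nat (j + int (4 * M) - int M)" using that False deg by linarith
    ultimately show ?thesis by (simp add: coeff_eq_0)
  qed
  \<comment> \<open>Shifting the coefficients by \<open>M\<close> contributes only a unimodular
    phase, so zeros of the transform are roots of \<open>p\<close>; the index set \<open>?K\<close>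
    is symmetric, which absorbs the sign in \<open>w (- k)\<close>.\<close>
  have dft: "dft (4 * M) f k = cis (- 2 * pi * real M * of_int k / real (4 * M)) * poly p (w (- k))" for k
  proof -
    have "dft (4 * M) f k = (\<Sum>r\<in>{M..<4 * M}. coeff p (r - M) * cis (- 2 * pi * real r * of_int k / real (4 * M)))"
      unfolding dft_def by (rule sum.mono_neutral_cong_right) (auto simp: f_def Let_def nat_diff_distrib)
    also have "\<dots> = (\<Sum>i\<in>{..<3 * M}. coeff p i * cis (- 2 * pi * real (i + M) * of_int k / real (4 * M)))"
      by (rule sum.reindex_bij_witness[of _ "\<lambda>i. i + M" "\<lambda>r. r - M"]) auto
    also have "\<dots> = (\<Sum>i\<in>{..<3 * M}. cis (- 2 * pi * real M * of_int k / real (4 * M)) * (coeff p i * w (- k) ^ i))"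
    proof (intro sum.cong refl)
      fix i
      have "w (- k) ^ i = cis (real i * (2 * pi * of_int (- k) / real (4 * M)))"
        unfolding w_def by (rule Complex.DeMoivre)
      moreover have "- 2 * pi * real (i + M) * of_int k / real (4 * M) =
          - 2 * pi * real M * of_int k / real (4 * M) + real i * (2 * pi * of_int (- k) / real (4 * M))"
        using M by (simp add: field_simps)
      ultimately have "cis (- 2 * pi * real (i + M) * of_int k / real (4 * M)) =
          cis (- 2 * pi * real M * of_int k / real (4 * M)) * w (- k) ^ i"
        by (simp only: cis_mult[symmetric])
      then show "coeff p i * cis (- 2 * pi * real (i + M) * of_int k / real (4 * M)) =
          cis (- 2 * pi * real M * of_int k / real (4 * M)) * (coeff p i * w (- k) ^ i)" by simp
    qed
    also have "\<dots> = cis (- 2 * pi * real M * of_int k / real (4 * M)) * (\<Sum>i\<in>{..<3 * M}. coeff p i * w (- k) ^ i)"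
      by (rule sum_distrib_left[symmetric])
    also have "(\<Sum>i\<in>{..<3 * M}. coeff p i * w (- k) ^ i) = poly p (w (- k))"
      unfolding poly_altdef using M deg by (intro sum.mono_neutral_right) (auto simp: coeff_eq_0)
    finally show ?thesis .
  qed
  have poly: "poly p z = (\<Prod>k\<in>?K. z - w k)" for z
    by (simp add: p_def poly_prod)
  show ?thesis
  proof (rule that[of f])
    show "dft (4 * M) f k = 0" if "\<bar>k\<bar> < int M" for k
    proof -
      have "- k \<in> ?K" using that by (auto simp: abs_less_iff)
      then have "poly p (w (- k)) = 0" unfolding poly by (intro prod_zero) auto
      then show ?thesis by (simp add: dft)
    qed
    have "f (int (3 * M - 1)) = coeff p (2 * M - 1)"
      using M by (simp add: f_def Let_def nat_diff_distrib nat_mult_distrib of_nat_diff)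
    then have "f (int (3 * M - 1)) \<noteq> 0" using lead deg by simp
    then show "\<exists>j. f j \<noteq> 0" by blast
    \<comment> \<open>This point is -1, while all the roots have arguments strictly between
      \<open>- pi / 2\<close> and \<open>pi / 2\<close>.\<close>
    have "w (- (2 * int M)) \<noteq> w k" if "k \<in> ?K" for k
    proof
      assume eq: "w (- (2 * int M)) = w k"
      have "- 1 = cis (- pi)" by (simp add: complex_eq_iff)
      also have "\<dots> = w (- (2 * int M))"
        unfolding w_def using M by (intro arg_cong[where f=cis]) (simp add: field_simps)
      finally have "cis (2 * pi * of_int k / real (4 * M)) = - 1" using eq by (simp add: w_def)
      then have "cos (2 * pi * of_int k / real (4 * M)) = - 1" by (simp add: complex_eq_iff)
      moreover have "0 < cos (2 * pi * of_int k / real (4 * M))"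
      proof (rule cos_gt_zero_pi)
        have k: "- real M < real_of_int k" "real_of_int k < real M" using that by auto
        note mult_strict_left_mono[OF k(1) pi_gt_zero] mult_strict_left_mono[OF k(2) pi_gt_zero]
        then
        show "- (pi / 2) < 2 * pi * of_int k / real (4 * M)" "2 * pi * of_int k / real (4 * M) < pi / 2"
          using M by (auto simp: field_simps)
      qed
      ultimately show False by simp
    qed
    then have "poly p (w (- (2 * int M))) \<noteq> 0" unfolding poly by auto
    then have "dft (4 * M) f (2 * int M) \<noteq> 0" by (simp add: dft)
    then show "\<exists>k. dft (4 * M) f k \<noteq> 0" by blast
  qed (use per gap in auto)
qed

section \<open>Incommensurability of the spacings and choice of the parameters\<close>

lemma sqrt_2_irrational: "sqrt 2 \<notin> \<rat>"
proof
  assume "sqrt 2 \<in> \<rat>"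
  then obtain m n :: nat where n: "n \<noteq> 0" and eq: "\<bar>sqrt 2\<bar> = real m / real n" and cop: "coprime m n"
    by (rule Rats_abs_nat_div_natE)
  from eq n have "real m = sqrt 2 * real n" by (simp add: field_simps)
  then have "(real m)\<^sup>2 = 2 * (real n)\<^sup>2" by (simp add: power_mult_distrib)
  then have mn: "m\<^sup>2 = 2 * n\<^sup>2"
    by (metis of_nat_eq_iff of_nat_mult of_nat_numeral of_nat_power)
  then have "even m" by (metis dvd_triv_left even_power)
  then obtain k where "m = 2 * k" by (elim dvdE)
  then have "n\<^sup>2 = 2 * k\<^sup>2" using mn by (simp add: power_mult_distrib)
  then have "even n" by (metis dvd_triv_left even_power)
  then show False using coprime_common_divisor[OF cop \<open>even m\<close>] by simp
qed

text \<open>Comparison of coefficients over the rationals: the \<open>sqrt 2\<close> part forces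
  \<open>i = j\<close>, and the rational part then forces \<open>(n - m) * i = 0\<close>.\<close>

lemma add_sqrt2_incommensurable:
  fixes i j n m :: int
  assumes "(of_int n + sqrt 2) * of_int i = (of_int m + sqrt 2) * of_int j" "n \<noteq> m"
  shows "i = 0"
proof -
  have eq: "sqrt 2 * of_int (i - j) = of_int (m * j - n * i)" using assms(1) by (simp add: algebra_simps)
  have "i = j"
  proof (rule ccontr)
    assume "i \<noteq> j"
    then have "sqrt 2 = of_int (m * j - n * i) / of_int (i - j)" using eq by (simp add: eq_divide_eq)
    then have "sqrt 2 \<in> \<rat>" by (metis Rats_divide Rats_of_int)
    then show False using sqrt_2_irrational by simp
  qed
  then show ?thesis using eq assms(2) by (simp add: algebra_simps)
qed

theorem theorem1:
  "\<exists>(\<Lambda> :: real set) (S :: real set) (c :: real \<Rightarrow> complex) (d :: real \<Rightarrow> complex).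
     discrete_subset \<Lambda> \<and> discrete_subset S \<and>
     (\<forall>l \<in> \<Lambda>. c l \<noteq> 0) \<and> (\<forall>s \<in> S. d s \<noteq> 0) \<and>
     translation_bounded_measure (point_sum \<Lambda> c) \<and>
     has_fourier_transform (point_sum \<Lambda> c) (point_sum S d) \<and>
     translation_bounded_measure (point_sum S d) \<and>
     \<not> in_finite_union_of_APs \<Lambda> \<and> \<not> in_finite_union_of_APs S \<and>
     \<not> finitely_poisson_derived (point_sum \<Lambda> c)"
proof -
  \<comment> \<open>With \<open>h n = 1 / (n + sqrt 2)\<close>, the gap \<open>M n * h n\<close> is
    at least \<open>n\<close>; the dual gap is \<open>(n + sqrt 2) / 4\<close> whatever
    \<open>M\<close> is.\<close>
  define M where "M n = (n + 2)\<^sup>2" for n :: nat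
  define N where "N n = 4 * M n" for n
  have M: "0 < M n" for n by (simp add: M_def)
  have N: "0 < N n" for n using M by (simp add: N_def)
  have "\<exists>f. (\<forall>j. f (j + int (N n)) = f j) \<and> (\<forall>j. \<bar>j\<bar> < int (M n) \<longrightarrow> f j = 0) \<and>
      (\<forall>k. \<bar>k\<bar> < int (M n) \<longrightarrow> dft (N n) f k = 0) \<and> (\<exists>j. f j \<noteq> 0) \<and> (\<exists>k. dft (N n) f k \<noteq> 0)" for n
    unfolding N_def using periodic_double_gap[OF M[of n]] by metis
  then obtain f where f: "\<And>n j. f n (j + int (N n)) = f n j" "\<And>n j. \<bar>j\<bar> < int (M n) \<Longrightarrow> f n j = 0"
    "\<And>n k. \<bar>k\<bar> < int (M n) \<Longrightarrow> dft (N n) (f n) k = 0" "\<And>n. \<exists>j. f n j \<noteq> 0" "\<And>n. \<exists>k. dft (N n) (f n) k \<noteq> 0"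
    by metis
  define F where "F n = (\<Sum>r<N n. cmod (f n (int r)))" for n
  have F0: "0 \<le> F n" for n by (simp add: F_def sum_nonneg)
  define h where "h n = 1 / (real n + sqrt 2)" for n
  \<comment> \<open>The dual spacing \<open>1 / (N n * h n)\<close>, rewritten so that it is a
    positive rational multiple of \<open>n + sqrt 2\<close>.\<close>
  define h' where "h' n = (real n + sqrt 2) / N n" for n
  have n2: "0 < real n + sqrt 2" for n by (simp add: add_nonneg_pos)
  have h: "0 < h n" and h': "0 < h' n" for n using n2 N by (simp_all add: h_def h'_def)
  have hh': "of_int k / (N n * h n) = h' n * of_int k" "1 / (N n * h n) = h' n" for n k
    by (simp_all add: h_def h'_def)
  \<comment> \<open>Dominates the unit-window masses of both the weight and its transform; the added
    ones keep it positive, so that division by it is safe.\<close>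
  define D where "D n = (F n + 1) * (1 / h n + 1) + (F n * h' n + 1) * (1 / h' n + 1)" for n
  define \<epsilon> where "\<epsilon> n = (1 / 2) ^ n / D n" for n
  have X: "0 \<le> F n * (1 / h n + 1)" "0 \<le> F n * h' n * (1 / h' n + 1)" "0 < 1 / h n + 1" "0 < 1 / h' n + 1" for n
    using F0[of n] h[of n] h'[of n] by (auto intro!: mult_nonneg_nonneg add_pos_pos add_nonneg_nonneg)
  have D: "0 < D n" "F n * (1 / h n + 1) \<le> D n" "F n * h' n * (1 / h' n + 1) \<le> D n" for n
    unfolding D_def distrib_right[of _ 1] using X[of n] by (simp_all del: add_divide_distrib)
  have \<epsilon>: "0 < \<epsilon> n" for n using D by (simp add: \<epsilon>_def)
  have \<epsilon>D: "\<epsilon> n * x \<le> (1 / 2) ^ n" if "x \<le> D n" for n x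
    using mult_left_mono[OF that, of "\<epsilon> n"] \<epsilon>[of n] D(1)[of n] by (simp add: \<epsilon>_def)
  define a where "a n j = of_real (\<epsilon> n) * f n j" for n j
  \<comment> \<open>These weights are forced by Poisson summation: \<open>h' n\<close> is its
    normalisation \<open>1 / (N n * h n)\<close>.\<close>
  define b where "b n k = of_real (\<epsilon> n * h' n) * dft (N n) (f n) k" for n k
  interpret \<nu>: incommensurable_combs h a "\<lambda>n. \<epsilon> n * F n"
  proof
    fix n m :: nat and i j :: int
    show "h n * of_int i \<noteq> h m * of_int j" if "n \<noteq> m" "i \<noteq> 0"
    proof
      assume "h n * of_int i = h m * of_int j"
      then have "(real m + sqrt 2) * of_int i = (real n + sqrt 2) * of_int j"
        using n2[of n] n2[of m] by (simp add: h_def field_simps)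
      then show False using add_sqrt2_incommensurable[of "int m" i "int n" j] that by simp
    qed
    show "cmod (a n j) \<le> \<epsilon> n * F n"
      using cmod_periodic_le[of "N n" "f n" j] N f(1) \<epsilon>[of n] by (simp add: a_def norm_mult F_def)
    show "\<epsilon> n * F n * (1 / h n + 1) \<le> (1 / 2) ^ n"
      using \<epsilon>D[OF D(2)] by (simp only: mult.assoc)
    show "a n 0 = 0" using f(2)[of 0 n] M by (simp add: a_def)
    show "infinite {j. a n j \<noteq> 0}"
    proof -
      obtain j where "f n j \<noteq> 0" using f(4) by blast
      then show ?thesis
        using infinite_periodic_nonzero[of "N n" "f n", OF N f(1)] \<epsilon>[of n] by (simp add: a_def)
    qed
    show "real n \<le> 4 * (h n * \<bar>of_int j\<bar>)" if "a n j \<noteq> 0"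
    proof -
      have "int (M n) \<le> \<bar>j\<bar>" using that f(2)[of j n] by (auto simp: a_def not_less[symmetric])
      then have "real (M n) \<le> \<bar>of_int j\<bar>" by linarith
      moreover have "real n * (real n + sqrt 2) \<le> 4 * real (M n)"
      proof -
        have "real n + sqrt 2 \<le> real n + 2" using sqrt2_less_2 by simp
        then have "real n * (real n + sqrt 2) \<le> (real n + 2) * (real n + 2)" by (intro mult_mono) auto
        moreover have "real (M n) = (real n + 2) * (real n + 2)" by (simp add: M_def power2_eq_square algebra_simps)
        ultimately show ?thesis by linarith
      qed
      ultimately show ?thesis using n2[of n] by (simp add: h_def field_simps)
    qed
  qed (rule h)
  interpret \<mu>: incommensurable_combs h' b "\<lambda>n. \<epsilon> n * (F n * h' n)"
  proof
    fix n m :: nat and i j :: int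
    show "h' n * of_int i \<noteq> h' m * of_int j" if "n \<noteq> m" "i \<noteq> 0"
    proof
      assume "h' n * of_int i = h' m * of_int j"
      \<comment> \<open>Clearing the denominators multiplies the indices by nonzero integers, which
        reduces the dual lattices to the same irrationality argument.\<close>
      then have "(real n + sqrt 2) * of_int (i * int (N m)) = (real m + sqrt 2) * of_int (j * int (N n))"
        using N[of n] N[of m] by (simp add: h'_def field_simps)
      then show False using add_sqrt2_incommensurable[of "int n" "i * int (N m)" "int m" "j * int (N n)"] that N[of m] by simp
    qed
    show "cmod (b n j) \<le> \<epsilon> n * (F n * h' n)"
      using cmod_dft_le[of "N n" "f n" j] \<epsilon>[of n] h'[of n] by (simp add: b_def norm_mult F_def mult_ac)
    show "\<epsilon> n * (F n * h' n) * (1 / h' n + 1) \<le> (1 / 2) ^ n"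
      using \<epsilon>D[OF D(3)] by (simp only: mult.assoc)
    show "b n 0 = 0" using f(3)[of 0 n] M by (simp add: b_def)
    show "infinite {j. b n j \<noteq> 0}"
    proof -
      obtain k where "dft (N n) (f n) k \<noteq> 0" using f(5) by blast
      then show ?thesis
        using infinite_periodic_nonzero[of "N n" "dft (N n) (f n)", OF N dft_periodic[OF N]] \<epsilon>[of n] h'[of n]
        by (simp add: b_def)
    qed
    show "real n \<le> 4 * (h' n * \<bar>of_int j\<bar>)" if "b n j \<noteq> 0"
    proof -
      have "int (M n) \<le> \<bar>j\<bar>" using that f(3)[of j n] by (auto simp: b_def not_less[symmetric])
      then have "real (M n) \<le> \<bar>of_int j\<bar>" by linarith
      then have "h' n * real (M n) \<le> h' n * \<bar>of_int j\<bar>" using h'[of n] by simp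
      \<comment> \<open>Since \<open>N n = 4 * M n\<close>, this is an equality; it accounts for the
        constant 4 in \<open>escape\<close>.\<close>
      moreover have "4 * (h' n * real (M n)) = real n + sqrt 2" using M[of n] by (simp add: h'_def N_def)
      moreover have "0 \<le> sqrt 2" by simp
      ultimately show ?thesis by linarith
    qed
  qed (rule h')
  have "cm_integral (point_sum \<nu>.supp \<nu>.weight) (fourier \<phi>) = cm_integral (point_sum \<mu>.supp \<mu>.weight) \<phi>"
    if \<phi>: "schwartz \<phi>" for \<phi>
  proof -
    obtain C where C: "\<And>\<xi>. cmod (fourier \<phi> \<xi>) \<le> C / (1 + \<xi>\<^sup>2)" using fourier_schwartz_decay[OF \<phi>] by blast
    have "cm_integral (point_sum \<nu>.supp \<nu>.weight) (fourier \<phi>) =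
        (\<Sum>\<^sub>\<infinity>n. \<Sum>\<^sub>\<infinity>j. a n j * fourier \<phi> (h n * of_int j))"
      by (rule \<nu>.cm_integral_decay[OF fourier_measurable[OF schwartz_measurable[OF \<phi>]] C])
    also have "\<dots> = (\<Sum>\<^sub>\<infinity>n. \<Sum>\<^sub>\<infinity>k. b n k * \<phi> (h' n * of_int k))"
    proof (rule infsum_cong)
      fix n
      have "(\<Sum>\<^sub>\<infinity>j. a n j * fourier \<phi> (h n * of_int j)) = of_real (\<epsilon> n) * (\<Sum>\<^sub>\<infinity>j. f n j * fourier \<phi> (h n * of_int j))"
        unfolding a_def mult.assoc by (rule infsum_cmult_right')
      also have "(\<Sum>\<^sub>\<infinity>j. f n j * fourier \<phi> (h n * of_int j)) =
          (\<Sum>\<^sub>\<infinity>k. dft (N n) (f n) k / of_real (N n * h n) * \<phi> (of_int k / (N n * h n)))"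
        by (rule poisson_summation_periodic) (rule \<phi> h N f(1))+
      also have "of_real (\<epsilon> n) * \<dots> =
          (\<Sum>\<^sub>\<infinity>k. of_real (\<epsilon> n) * (dft (N n) (f n) k / of_real (N n * h n) * \<phi> (of_int k / (N n * h n))))"
        by (rule infsum_cmult_right'[symmetric])
      also have "\<dots> = (\<Sum>\<^sub>\<infinity>k. b n k * \<phi> (h' n * of_int k))"
        unfolding hh'(1) by (rule infsum_cong) (simp add: b_def hh'(2)[symmetric])
      finally show "(\<Sum>\<^sub>\<infinity>j. a n j * fourier \<phi> (h n * of_int j)) = (\<Sum>\<^sub>\<infinity>k. b n k * \<phi> (h' n * of_int k))" .
    qed
    also have "\<dots> = cm_integral (point_sum \<mu>.supp \<mu>.weight) \<phi>"
      by (rule \<mu>.cm_integral_decay[OF schwartz_measurable[OF \<phi>] schwartz_decay[OF \<phi>], symmetric])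
    finally show ?thesis .
  qed
  then have "has_fourier_transform (point_sum \<nu>.supp \<nu>.weight) (point_sum \<mu>.supp \<mu>.weight)"
    unfolding has_fourier_transform_def fourier_distribution_def
    using \<nu>.tempered \<mu>.tempered by blast
  then show ?thesis
    using \<nu>.discrete_supp \<mu>.discrete_supp \<nu>.weight_nonzero \<mu>.weight_nonzero
      \<nu>.translation_bounded \<mu>.translation_bounded \<nu>.not_in_finite_union_of_APs
      \<mu>.not_in_finite_union_of_APs \<nu>.not_finitely_poisson_derived
    by blast
qed

end
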